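(* There is an absolute constant $c>0$ such that the following holds. Let $k$ be a positive integer and let $\varepsilon_1,\varepsilon_2$ satisfy $0.01 \le \varepsilon_1 < \varepsilon_2 \le 0.49$ and $\varepsilon_2 - \varepsilon_1 \ge 2^{-O(k^{0.99})}$. Then any $(k,\varepsilon_1,\varepsilon_2)$-tolerant junta tester (possibly adaptive) must make at least $k^{-\Omega(\log(\varepsilon_2-\varepsilon_1))}$ queries, i.e. at least $k^{-c\log(\varepsilon_2-\varepsilon_1)}$ queries.
   Context: A function $f:\{0,1\}^n\to\{0,1\}$ is a $k$-junta if it depends on at most $k$ of its input variables. The distance between $f,g:\{0,1\}^n\to\{0,1\}$ is $\Pr_{x\sim\{0,1\}^n}[f(x)\neq g(x)]$ ($x$ uniform); $f$ is $\varepsilon$-close to a $k$-junta if its distance to some $k$-junta is at most $\varepsilon$, and $\varepsilon$-far from $k$-juntas if its distance to every $k$-junta is at least $\varepsilon$. A $(k,\varepsilon_1,\varepsilon_2)$-tolerant junta tester is a randomized algorithm with query access to $f:\{0,1\}^n\to\{0,1\}$ (queries may depend on previous answers) that accepts with probability at least $2/3$ if $f$ is $\varepsilon_1$-close to a $k$-junta and rejects with probability at least $2/3$ if $f$ is $\varepsilon_2$-far from $k$-juntas. Logarithms are base 2. *)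

theory Defs
  imports "HOL-Probability.Probability"
begin

text \<open>
  The cube \<open>{0,1}\<^sup>n\<close> is the set of bit lists of length \<open>n\<close>.  A function \<open>{0,1}\<^sup>n \<rightarrow> {0,1}\<close> is
  represented by a function on all bit lists, of which only the values on \<open>cube n\<close> matter.
\<close>

definition cube :: "nat \<Rightarrow> bool list set" where
  "cube n = {x. length x = n}"

definition depends_on :: "nat \<Rightarrow> (bool list \<Rightarrow> bool) \<Rightarrow> nat \<Rightarrow> bool" where
  "depends_on n f i \<longleftrightarrow> (\<exists>x \<in> cube n. f (x[i := \<not> x ! i]) \<noteq> f x)"

definition junta :: "nat \<Rightarrow> nat \<Rightarrow> (bool list \<Rightarrow> bool) \<Rightarrow> bool" where
  "junta n k f \<longleftrightarrow> card {i. i < n \<and> depends_on n f i} \<le> k"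

definition distance :: "nat \<Rightarrow> (bool list \<Rightarrow> bool) \<Rightarrow> (bool list \<Rightarrow> bool) \<Rightarrow> real" where
  "distance n f g = measure_pmf.prob (pmf_of_set (cube n)) {x. f x \<noteq> g x}"

definition close_to_junta :: "nat \<Rightarrow> nat \<Rightarrow> real \<Rightarrow> (bool list \<Rightarrow> bool) \<Rightarrow> bool" where
  "close_to_junta n k \<epsilon> f \<longleftrightarrow> (\<exists>g. junta n k g \<and> distance n f g \<le> \<epsilon>)"

definition far_from_juntas :: "nat \<Rightarrow> nat \<Rightarrow> real \<Rightarrow> (bool list \<Rightarrow> bool) \<Rightarrow> bool" where
  "far_from_juntas n k \<epsilon> f \<longleftrightarrow> (\<forall>g. junta n k g \<longrightarrow> distance n f g \<ge> \<epsilon>)"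

text \<open>
  A deterministic adaptive query algorithm is a decision tree: \<open>Query x t0 t1\<close> queries the point
  \<open>x\<close> and continues with \<open>t0\<close> or \<open>t1\<close> if the answer is \<open>0\<close> or \<open>1\<close>, respectively;
  \<open>Answer True\<close> accepts and \<open>Answer False\<close> rejects.
\<close>

datatype query_tree = Answer bool | Query "bool list" query_tree query_tree

primrec queries_within :: "bool list set \<Rightarrow> query_tree \<Rightarrow> bool" where
  "queries_within X (Answer b) \<longleftrightarrow> True"
| "queries_within X (Query x t0 t1) \<longleftrightarrow> x \<in> X \<and> queries_within X t0 \<and> queries_within X t1"

primrec accepts :: "(bool list \<Rightarrow> bool) \<Rightarrow> query_tree \<Rightarrow> bool" where
  "accepts f (Answer b) \<longleftrightarrow> b"
| "accepts f (Query x t0 t1) \<longleftrightarrow> (if f x then accepts f t1 else accepts f t0)"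

primrec num_queries :: "(bool list \<Rightarrow> bool) \<Rightarrow> query_tree \<Rightarrow> nat" where
  "num_queries f (Answer b) = 0"
| "num_queries f (Query x t0 t1) = Suc (if f x then num_queries f t1 else num_queries f t0)"

text \<open>
  A randomized query algorithm is a probability distribution over deterministic ones.  There are
  only countably many decision trees, so discrete distributions lose no generality.
\<close>

definition tolerant_junta_tester ::
    "nat \<Rightarrow> nat \<Rightarrow> real \<Rightarrow> real \<Rightarrow> query_tree pmf \<Rightarrow> bool" where
  "tolerant_junta_tester n k \<epsilon>1 \<epsilon>2 T \<longleftrightarrow>
     (\<forall>t \<in> set_pmf T. queries_within (cube n) t) \<and>
     (\<forall>f. (close_to_junta n k \<epsilon>1 f \<longrightarrow> measure_pmf.prob T {t. accepts f t} \<ge> 2 / 3) \<and>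
          (far_from_juntas n k \<epsilon>2 f \<longrightarrow> measure_pmf.prob T {t. \<not> accepts f t} \<ge> 2 / 3))"

definition makes_at_most :: "nat \<Rightarrow> query_tree pmf \<Rightarrow> bool" where
  "makes_at_most q T \<longleftrightarrow> (\<forall>t \<in> set_pmf T. \<forall>f. num_queries f t \<le> q)"

end

theory Submission
  imports Defs
begin

text \<open>
  Let \<open>f\<close> be a uniformly random function of \<open>k + a\<close> variables.  Averaging over \<open>a\<close> variables
  leaves a bias of order \<open>2 powr (- a / 2)\<close>, so \<open>f\<close> is about that far below distance \<open>1 / 2\<close> from
  \<open>k\<close>-juntas.  If \<open>f\<close> is instead random subject to being invariant under flipping any of a
  constant number of hidden disjoint blocks of \<open>t\<close> variables, whose union has size \<open>a\<close>, then
  averaging over the hidden variables leaves a bias that is larger by a constant factor, and \<open>f\<close>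
  is closer to \<open>k\<close>-juntas.  The two cases look the same until two queries differ exactly in a
  union of blocks; for a random choice of the blocks this happens for a fixed pair of queries with
  probability about \<open>(a / k) ^ t\<close>, so about \<open>(k / a) powr (t / 2)\<close> queries are needed.  Setting
  \<open>f\<close> to \<open>0\<close> on a suitable part of the cube moves the two distances to the prescribed \<open>\<epsilon>1 < \<epsilon>2\<close>.
\<close>

section \<open>Random subsets of a finite set\<close>

abbreviation random_subset :: "'a set \<Rightarrow> 'a set pmf" where
  "random_subset U \<equiv> pmf_of_set (Pow U)"

abbreviation subset_prob :: "'a set \<Rightarrow> 'a set set \<Rightarrow> real" where
  "subset_prob U \<equiv> measure_pmf.prob (random_subset U)"

abbreviation subset_expectation :: "'a set \<Rightarrow> ('a set \<Rightarrow> real) \<Rightarrow> real" where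
  "subset_expectation U \<equiv> measure_pmf.expectation (random_subset U)"

abbreviation subset_variance :: "'a set \<Rightarrow> ('a set \<Rightarrow> real) \<Rightarrow> real" where
  "subset_variance U f \<equiv> measure_pmf.variance (random_subset U) f"

lemma integrable_random_subset [simp]:
  fixes f :: "'a set \<Rightarrow> real"
  assumes "finite U"
  shows "integrable (measure_pmf (random_subset U)) f"
  by (rule integrable_measure_pmf_finite) (simp add: assms Pow_not_empty set_pmf_of_set)

lemma subset_expectation_eq:
  fixes f :: "'a set \<Rightarrow> real"
  assumes "finite U"
  shows "subset_expectation U f = (\<Sum>G \<in> Pow U. f G) / 2 ^ card U"
  using assms by (simp add: integral_pmf_of_set Pow_not_empty card_Pow)

lemma subset_expectation_insert:
  fixes f :: "'a set \<Rightarrow> real"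
  assumes "finite U" "x \<notin> U"
  shows "subset_expectation (insert x U) f
    = (subset_expectation U f + subset_expectation U (\<lambda>G. f (insert x G))) / 2"
proof -
  have "inj_on (insert x) (Pow U)"
    using assms(2) by (auto simp: inj_on_def)
  moreover have "Pow U \<inter> insert x ` Pow U = {}"
    using assms(2) by auto
  ultimately have "(\<Sum>G \<in> Pow (insert x U). f G) = (\<Sum>G \<in> Pow U. f G) + (\<Sum>G \<in> Pow U. f (insert x G))"
    using assms(1) by (simp add: Pow_insert sum.union_disjoint sum.reindex)
  then show ?thesis
    using assms by (simp add: subset_expectation_eq add_divide_distrib)
qed

lemma subset_prob_mono:
  assumes "finite U" "\<And>G. G \<subseteq> U \<Longrightarrow> G \<in> A \<Longrightarrow> G \<in> B"
  shows "subset_prob U A \<le> subset_prob U B"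
  using assms
  by (intro measure_pmf.finite_measure_mono_AE) (auto simp: AE_measure_pmf_iff Pow_not_empty)

lemma subset_prob_agree:
  assumes "finite U" "D \<subseteq> U"
  shows "subset_prob U {G. \<forall>x \<in> D. (x \<in> G) = v x} = (1 / 2) ^ card D"
proof -
  have "bij_betw (\<lambda>G. G - D) (Pow U \<inter> {G. \<forall>x \<in> D. (x \<in> G) = v x}) (Pow (U - D))"
    by (rule bij_betw_byWitness[where f' = "\<lambda>H. H \<union> {x \<in> D. v x}"]) (use assms(2) in auto)
  then have "card (Pow U \<inter> {G. \<forall>x \<in> D. (x \<in> G) = v x}) = 2 ^ (card U - card D)"
    using assms by (simp add: bij_betw_same_card card_Pow card_Diff_subset finite_subset)
  then have "subset_prob U {G. \<forall>x \<in> D. (x \<in> G) = v x} = 2 ^ (card U - card D) / 2 ^ card U"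
    using assms(1) by (simp add: measure_pmf_of_set Pow_not_empty card_Pow)
  also have "\<dots> = (1 / 2) ^ card D"
    using card_mono[OF assms] by (simp add: power_diff power_divide)
  finally show ?thesis .
qed

lemma subset_variance_insert:
  fixes f :: "'a set \<Rightarrow> real"
  assumes "finite U" "x \<notin> U"
  shows "subset_variance (insert x U) f
    = (subset_variance U f + subset_variance U (\<lambda>G. f (insert x G))) / 2
      + (subset_expectation U (\<lambda>G. f (insert x G)) - subset_expectation U f)\<^sup>2 / 4"
proof -
  have halves: "(a + b) / 2 - ((c + d) / 2)\<^sup>2 = ((a - c\<^sup>2) + (b - d\<^sup>2)) / 2 + (d - c)\<^sup>2 / 4"
    for a b c d :: real
    by (simp add: power2_eq_square field_simps)
  have variance: "subset_variance S g
      = subset_expectation S (\<lambda>G. (g G)\<^sup>2) - (subset_expectation S g)\<^sup>2"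
    if "finite S" for S and g :: "'a set \<Rightarrow> real"
    using that by (intro measure_pmf.variance_eq) auto
  show ?thesis
    unfolding variance[OF assms(1)] variance[OF finite.insertI[OF assms(1)]]
    unfolding subset_expectation_insert[OF assms] by (rule halves)
qed

lemma Efron_Stein_subset_variance_le:
  fixes f :: "'a set \<Rightarrow> real"
  assumes "finite U"
    and "\<And>G x. G \<subseteq> U \<Longrightarrow> x \<in> U \<Longrightarrow> x \<notin> G \<Longrightarrow> \<bar>f (insert x G) - f G\<bar> \<le> c"
  shows "subset_variance U f \<le> real (card U) * c\<^sup>2 / 4"
  using assms
proof (induction U arbitrary: f rule: finite_induct)
  case empty
  then show ?case by (simp add: pmf_of_set_singleton)
next
  case (insert x U)
  let ?E = "subset_expectation U"
  let ?V = "subset_variance U"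
  let ?f' = "\<lambda>G. f (insert x G)"
  have lipschitz_x: "\<bar>f (insert x G) - f G\<bar> \<le> c" if "G \<subseteq> U" for G
    using insert.prems[of G x] that insert.hyps by blast
  have "\<bar>?E ?f' - ?E f\<bar> = \<bar>?E (\<lambda>G. ?f' G - f G)\<bar>"
    using insert.hyps by simp
  also have "\<dots> \<le> ?E (\<lambda>G. \<bar>?f' G - f G\<bar>)"
    by (rule integral_abs_bound)
  also have "\<dots> \<le> c"
    using insert.hyps lipschitz_x
    by (intro measure_pmf.integral_le_const) (auto simp: AE_measure_pmf_iff Pow_not_empty)
  finally have mean_diff: "(?E ?f' - ?E f)\<^sup>2 \<le> c\<^sup>2"
    by (simp add: abs_le_square_iff[symmetric])
  have "?V f \<le> real (card U) * c\<^sup>2 / 4"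
    by (rule insert.IH) (use insert.prems in blast)
  moreover have "?V ?f' \<le> real (card U) * c\<^sup>2 / 4"
  proof (rule insert.IH)
    fix G y assume "G \<subseteq> U" "y \<in> U" "y \<notin> G"
    then show "\<bar>f (insert x (insert y G)) - f (insert x G)\<bar> \<le> c"
      using insert.prems[of "insert x G" y] insert.hyps by (auto simp: insert_commute)
  qed
  ultimately show ?case
    using mean_diff insert.hyps unfolding subset_variance_insert[OF insert.hyps(1,2)]
    by (simp add: field_simps)
qed

lemma subset_prob_deviation_le:
  fixes f :: "'a set \<Rightarrow> real"
  assumes "finite U"
    and "\<And>G x. G \<subseteq> U \<Longrightarrow> x \<in> U \<Longrightarrow> x \<notin> G \<Longrightarrow> \<bar>f (insert x G) - f G\<bar> \<le> c"
    and "0 < \<delta>"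
  shows "subset_prob U {G. \<delta> \<le> \<bar>f G - subset_expectation U f\<bar>} \<le> real (card U) * c\<^sup>2 / (4 * \<delta>\<^sup>2)"
proof -
  have "subset_prob U {G. \<delta> \<le> \<bar>f G - subset_expectation U f\<bar>} \<le> subset_variance U f / \<delta>\<^sup>2"
    using measure_pmf.Chebyshev_inequality[of f "random_subset U" \<delta>] assms(1,3) by simp
  also have "\<dots> \<le> (real (card U) * c\<^sup>2 / 4) / \<delta>\<^sup>2"
    using Efron_Stein_subset_variance_le[OF assms(1,2)] by (intro divide_right_mono) auto
  finally show ?thesis by simp
qed

lemma (in prob_space) expectation_abs_squared_le:
  fixes X :: "'a \<Rightarrow> real"
  assumes "integrable M X" "integrable M (\<lambda>x. (X x)\<^sup>2)"
  shows "(expectation (\<lambda>x. \<bar>X x\<bar>))\<^sup>2 \<le> expectation (\<lambda>x. (X x)\<^sup>2)"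
  using variance_positive[of "\<lambda>x. \<bar>X x\<bar>"] assms by (subst (asm) variance_eq) auto

lemma quartic_le_abs:
  fixes x l :: real
  assumes "0 < l"
  shows "3 * x\<^sup>2 / (2 * l) - x ^ 4 / (2 * l ^ 3) \<le> \<bar>x\<bar>"
proof -
  define y where "y = \<bar>x\<bar> / l"
  have "2 * y - (3 * y\<^sup>2 - y ^ 4) = y * ((y - 1)\<^sup>2 * (y + 2))"
    by (simp add: power2_eq_square power4_eq_xxxx algebra_simps)
  also have "\<dots> \<ge> 0" using assms by (simp add: y_def)
  finally have "(3 * y\<^sup>2 - y ^ 4) * (l / 2) \<le> 2 * y * (l / 2)"
    using assms by (intro mult_right_mono) auto
  moreover have "3 * x\<^sup>2 / (2 * l) - x ^ 4 / (2 * l ^ 3) = (3 * y\<^sup>2 - y ^ 4) * (l / 2)"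
    using assms
    by (simp add: y_def power_divide field_simps power2_eq_square power3_eq_cube power4_eq_xxxx)
  ultimately show ?thesis using assms by (simp add: y_def)
qed

lemma (in prob_space) expectation_abs_ge_sqrt_second_moment:
  fixes X :: "'a \<Rightarrow> real"
  assumes "integrable M X" "integrable M (\<lambda>x. (X x)\<^sup>2)" "integrable M (\<lambda>x. X x ^ 4)"
    and "expectation (\<lambda>x. X x ^ 4) \<le> 3 * (expectation (\<lambda>x. (X x)\<^sup>2))\<^sup>2"
  shows "sqrt (expectation (\<lambda>x. (X x)\<^sup>2) / 3) \<le> expectation (\<lambda>x. \<bar>X x\<bar>)"
proof -
  define Q where "Q = expectation (\<lambda>x. (X x)\<^sup>2)"
  have "0 \<le> Q" by (simp add: Q_def)
  show ?thesis
  proof (cases "Q = 0")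
    case False
    define l where "l = sqrt (3 * Q)"
    have "0 < l" and l_square: "l\<^sup>2 = 3 * Q" using False \<open>0 \<le> Q\<close> by (auto simp: l_def)
    then have l_cube: "l ^ 3 = 3 * Q * l" by (simp add: power3_eq_cube power2_eq_square)
    have "Q / l = 3 * Q / (2 * l) - 3 * Q\<^sup>2 / (2 * l ^ 3)"
      using \<open>0 < l\<close> False by (simp add: l_cube field_simps power2_eq_square)
    also have "\<dots> \<le> 3 * Q / (2 * l) - expectation (\<lambda>x. X x ^ 4) / (2 * l ^ 3)"
      using assms(4) \<open>0 < l\<close> by (simp add: Q_def divide_right_mono)
    also have "\<dots> = expectation (\<lambda>x. 3 * (X x)\<^sup>2 / (2 * l) - X x ^ 4 / (2 * l ^ 3))"
      using assms by (simp add: Q_def)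
    also have "\<dots> \<le> expectation (\<lambda>x. \<bar>X x\<bar>)"
      using assms \<open>0 < l\<close> by (intro integral_mono quartic_le_abs) auto
    finally have "Q / l \<le> expectation (\<lambda>x. \<bar>X x\<bar>)" .
    moreover have "sqrt (Q / 3) = Q / l"
    proof (rule real_sqrt_unique)
      have "(Q / l)\<^sup>2 = Q\<^sup>2 / (3 * Q)" by (simp add: power_divide l_square)
      then show "(Q / l)\<^sup>2 = Q / 3" by (simp add: power2_eq_square)
    qed (use \<open>0 < l\<close> \<open>0 \<le> Q\<close> in simp)
    ultimately show ?thesis by (simp add: Q_def)
  qed (simp add: Q_def)
qed

section \<open>Random signs\<close>

definition bool_sign :: "bool \<Rightarrow> real" where
  "bool_sign b = (if b then 1 else -1)"

lemma bool_sign_simps [simp]: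
  "bool_sign True = 1" "bool_sign False = -1" "bool_sign b * bool_sign b = 1" "\<bar>bool_sign b\<bar> = 1"
  by (auto simp: bool_sign_def)

definition signed_sum :: "'a set \<Rightarrow> ('a \<Rightarrow> real) \<Rightarrow> 'a set \<Rightarrow> real" where
  "signed_sum U w G = (\<Sum>x \<in> U. w x * bool_sign (x \<in> G))"

lemma signed_sum_insert:
  assumes "finite U" "x \<notin> U" "G \<subseteq> U"
  shows "signed_sum (insert x U) w G = signed_sum U w G - w x"
    and "signed_sum (insert x U) w (insert x G) = signed_sum U w G + w x"
proof -
  have "x \<notin> G" using assms by auto
  then show "signed_sum (insert x U) w G = signed_sum U w G - w x"
    using assms by (simp add: signed_sum_def)
  have "y \<in> insert x G \<longleftrightarrow> y \<in> G" if "y \<in> U" for y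
    using that assms(2) by auto
  then have "signed_sum U w (insert x G) = signed_sum U w G"
    by (simp add: signed_sum_def)
  then show "signed_sum (insert x U) w (insert x G) = signed_sum U w G + w x"
    using assms by (simp add: signed_sum_def)
qed

lemma expectation_signed_sum_insert:
  fixes g :: "real \<Rightarrow> real"
  assumes "finite U" "x \<notin> U"
  shows "subset_expectation (insert x U) (\<lambda>G. g (signed_sum (insert x U) w G))
    = subset_expectation U (\<lambda>G. (g (signed_sum U w G - w x) + g (signed_sum U w G + w x)) / 2)"
  unfolding subset_expectation_insert[OF assms]
  using assms
  by (simp add: subset_expectation_eq signed_sum_insert sum.distrib flip: sum_divide_distrib)

lemma signed_sum_second_moment:
  assumes "finite U"
  shows "subset_expectation U (\<lambda>G. (signed_sum U w G)\<^sup>2) = (\<Sum>x \<in> U. (w x)\<^sup>2)"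
  using assms
proof (induction U rule: finite_induct)
  case empty
  then show ?case by (simp add: signed_sum_def)
next
  case (insert x U)
  have "((s - w x)\<^sup>2 + (s + w x)\<^sup>2) / 2 = s\<^sup>2 + (w x)\<^sup>2" for s
    by (simp add: power2_eq_square algebra_simps)
  then show ?case
    using insert by (simp add: expectation_signed_sum_insert[where g = "\<lambda>s. s\<^sup>2"])
qed

lemma signed_sum_fourth_moment_le:
  assumes "finite U"
  shows "subset_expectation U (\<lambda>G. signed_sum U w G ^ 4) \<le> 3 * (\<Sum>x \<in> U. (w x)\<^sup>2)\<^sup>2"
  using assms
proof (induction U rule: finite_induct)
  case empty
  then show ?case by (simp add: signed_sum_def)
next
  case (insert x U)
  let ?E = "subset_expectation U"
  have "((s - w x) ^ 4 + (s + w x) ^ 4) / 2 = s ^ 4 + 6 * (w x)\<^sup>2 * s\<^sup>2 + w x ^ 4" for s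
    by (simp add: power2_eq_square power4_eq_xxxx algebra_simps)
  then have "subset_expectation (insert x U) (\<lambda>G. signed_sum (insert x U) w G ^ 4)
      = ?E (\<lambda>G. signed_sum U w G ^ 4) + 6 * (w x)\<^sup>2 * (\<Sum>y \<in> U. (w y)\<^sup>2) + w x ^ 4"
    using insert.hyps
    by (simp add: expectation_signed_sum_insert[where g = "\<lambda>s. s ^ 4"] signed_sum_second_moment)
  also have "\<dots> \<le> 3 * (\<Sum>y \<in> U. (w y)\<^sup>2)\<^sup>2 + 6 * (w x)\<^sup>2 * (\<Sum>y \<in> U. (w y)\<^sup>2) + 3 * w x ^ 4"
    using insert.IH by (intro add_mono) auto
  also have "\<dots> = 3 * (\<Sum>y \<in> insert x U. (w y)\<^sup>2)\<^sup>2"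
    using insert.hyps by (simp add: power2_eq_square power4_eq_xxxx algebra_simps)
  finally show ?case .
qed

lemma Khinchine_signed_sum:
  assumes "finite U"
  shows "sqrt ((\<Sum>x \<in> U. (w x)\<^sup>2) / 3) \<le> subset_expectation U (\<lambda>G. \<bar>signed_sum U w G\<bar>)"
  using measure_pmf.expectation_abs_ge_sqrt_second_moment[of "random_subset U" "signed_sum U w"]
    signed_sum_second_moment[OF assms, of w] signed_sum_fourth_moment_le[OF assms, of w] assms
  by simp

lemma sum_bool_sign_eq_signed_sum:
  assumes "finite F" "finite U" "h ` F \<subseteq> U"
  shows "(\<Sum>x \<in> F. bool_sign (h x \<in> G)) = signed_sum U (\<lambda>y. real (card {x \<in> F. h x = y})) G"
proof -
  have "(\<Sum>x \<in> F. bool_sign (h x \<in> G)) = (\<Sum>y \<in> U. \<Sum>x \<in> {x \<in> F. h x = y}. bool_sign (h x \<in> G))"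
    by (rule sum.group[symmetric, OF assms])
  then show ?thesis by (simp add: signed_sum_def)
qed

lemma expectation_abs_sum_bool_sign_le:
  assumes "finite U" "F \<subseteq> U"
  shows "subset_expectation U (\<lambda>G. \<bar>\<Sum>x \<in> F. bool_sign (x \<in> G)\<bar>) \<le> sqrt (card F)"
proof (rule real_le_rsqrt)
  let ?w = "\<lambda>y. real (card {x \<in> F. x = y})"
  have "finite F" using assms finite_subset by blast
  then have signed_sum: "(\<Sum>x \<in> F. bool_sign (x \<in> G)) = signed_sum U ?w G" for G
    using sum_bool_sign_eq_signed_sum[OF _ assms(1), of F "\<lambda>x. x"] assms(2) by simp
  have "(subset_expectation U (\<lambda>G. \<bar>\<Sum>x \<in> F. bool_sign (x \<in> G)\<bar>))\<^sup>2 \<le> (\<Sum>y \<in> U. (?w y)\<^sup>2)"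
    unfolding signed_sum signed_sum_second_moment[OF assms(1), symmetric]
    using assms(1) by (intro measure_pmf.expectation_abs_squared_le) auto
  also have "\<dots> = (\<Sum>y \<in> F. 1)"
  proof (rule sum.mono_neutral_cong_right[OF assms(1,2)])
    show "(?w y)\<^sup>2 = 1" if "y \<in> F" for y
    proof -
      have "{x \<in> F. x = y} = {y}" using that by auto
      then show ?thesis by simp
    qed
    show "\<forall>y \<in> U - F. (?w y)\<^sup>2 = 0" by (auto simp: card_eq_0_iff)
  qed
  finally show "(subset_expectation U (\<lambda>G. \<bar>\<Sum>x \<in> F. bool_sign (x \<in> G)\<bar>))\<^sup>2 \<le> real (card F)"
    by simp
qed

lemma expectation_abs_sum_bool_sign_ge:
  assumes "finite F" "finite U" "h ` F \<subseteq> U"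
  shows "card F / sqrt (3 * card (h ` F))
    \<le> subset_expectation U (\<lambda>G. \<bar>\<Sum>x \<in> F. bool_sign (h x \<in> G)\<bar>)"
proof -
  define w where "w y = real (card {x \<in> F. h x = y})" for y
  have "real (card F) = (\<Sum>y \<in> h ` F. w y)"
    using sum.image_gen[OF assms(1), of "\<lambda>_. 1::real" h] by (simp add: w_def)
  then have "(real (card F))\<^sup>2 \<le> (\<Sum>y \<in> h ` F. (w y)\<^sup>2) * card (h ` F)"
    by (simp only: sum_squared_le_sum_of_squares)
  also have "\<dots> \<le> (\<Sum>y \<in> U. (w y)\<^sup>2) * card (h ` F)"
    using assms by (intro mult_right_mono sum_mono2) auto
  finally have "(real (card F))\<^sup>2 / (3 * card (h ` F)) \<le> (\<Sum>y \<in> U. (w y)\<^sup>2) / 3"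
    by (cases "card (h ` F) = 0") (auto simp: divide_le_eq sum_nonneg mult_ac)
  then have "card F / sqrt (3 * card (h ` F)) \<le> sqrt ((\<Sum>y \<in> U. (w y)\<^sup>2) / 3)"
    by (intro real_le_rsqrt) (simp add: power_divide)
  also have "\<dots> \<le> subset_expectation U (\<lambda>G. \<bar>signed_sum U w G\<bar>)"
    by (rule Khinchine_signed_sum[OF assms(2)])
  finally show ?thesis
    unfolding sum_bool_sign_eq_signed_sum[OF assms] w_def .
qed

section \<open>Sums over fibres\<close>

text \<open>The largest correlation of \<open>\<sigma>\<close> on \<open>U\<close> with a \<open>\<plusminus>1\<close>-valued function that factors through \<open>\<pi>\<close>.\<close>
definition fibre_sum :: "('a \<Rightarrow> 'b) \<Rightarrow> 'a set \<Rightarrow> ('a \<Rightarrow> real) \<Rightarrow> real" where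
  "fibre_sum \<pi> U \<sigma> = (\<Sum>y \<in> \<pi> ` U. \<bar>\<Sum>x \<in> {x \<in> U. \<pi> x = y}. \<sigma> x\<bar>)"

lemma fibre_sum_superset:
  assumes "finite J" "\<pi> ` U \<subseteq> J"
  shows "fibre_sum \<pi> U \<sigma> = (\<Sum>y \<in> J. \<bar>\<Sum>x \<in> {x \<in> U. \<pi> x = y}. \<sigma> x\<bar>)"
  unfolding fibre_sum_def
proof (rule sum.mono_neutral_left[OF assms])
  show "\<forall>y \<in> J - \<pi> ` U. \<bar>\<Sum>x \<in> {x \<in> U. \<pi> x = y}. \<sigma> x\<bar> = 0"
    by (auto intro!: sum.neutral)
qed

lemma fibre_sum_cong:
  assumes "\<And>x. x \<in> U \<Longrightarrow> \<pi> x = \<pi>' x" "\<And>x. x \<in> U \<Longrightarrow> \<sigma> x = \<sigma>' x"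
  shows "fibre_sum \<pi> U \<sigma> = fibre_sum \<pi>' U \<sigma>'"
  unfolding fibre_sum_def using assms
  by (intro sum.cong arg_cong[where f = abs]) (auto intro!: image_cong)

lemma fibre_sum_image:
  assumes "inj_on h U"
  shows "fibre_sum \<pi> (h ` U) \<sigma> = fibre_sum (\<lambda>x. \<pi> (h x)) U (\<lambda>x. \<sigma> (h x))"
  unfolding fibre_sum_def image_image
proof (intro sum.cong refl arg_cong[where f = abs])
  fix y
  have "{z \<in> h ` U. \<pi> z = y} = h ` {x \<in> U. \<pi> (h x) = y}" by auto
  moreover have "inj_on h {x \<in> U. \<pi> (h x) = y}" using assms by (auto simp: inj_on_def)
  ultimately show "(\<Sum>z \<in> {z \<in> h ` U. \<pi> z = y}. \<sigma> z) = (\<Sum>x \<in> {x \<in> U. \<pi> (h x) = y}. \<sigma> (h x))"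
    by (simp add: sum.reindex)
qed

lemma fibre_sum_le_sum_abs:
  assumes "finite U"
  shows "fibre_sum \<pi> U \<sigma> \<le> (\<Sum>x \<in> U. \<bar>\<sigma> x\<bar>)"
  unfolding fibre_sum_def sum.image_gen[OF assms, of "\<lambda>x. \<bar>\<sigma> x\<bar>" \<pi>]
  by (intro sum_mono sum_abs)

lemma fibre_sum_eq_sum_abs:
  assumes "finite U" "\<And>x y. x \<in> U \<Longrightarrow> y \<in> U \<Longrightarrow> \<pi> x = \<pi> y \<Longrightarrow> \<sigma> x = \<sigma> y"
  shows "fibre_sum \<pi> U \<sigma> = (\<Sum>x \<in> U. \<bar>\<sigma> x\<bar>)"
  unfolding fibre_sum_def sum.image_gen[OF assms(1), of "\<lambda>x. \<bar>\<sigma> x\<bar>" \<pi>]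
proof (intro sum.cong refl)
  fix y assume "y \<in> \<pi> ` U"
  then obtain c where "\<sigma> x = c" if "x \<in> {x \<in> U. \<pi> x = y}" for x using assms(2) by blast
  then show "\<bar>\<Sum>x \<in> {x \<in> U. \<pi> x = y}. \<sigma> x\<bar> = (\<Sum>x \<in> {x \<in> U. \<pi> x = y}. \<bar>\<sigma> x\<bar>)"
    by (simp add: abs_mult)
qed

lemma fibre_sum_diff_le:
  assumes "finite U"
  shows "\<bar>fibre_sum \<pi> U \<sigma> - fibre_sum \<pi> U \<sigma>'\<bar> \<le> (\<Sum>x \<in> U. \<bar>\<sigma> x - \<sigma>' x\<bar>)"
proof -
  let ?s = "\<lambda>\<sigma> y. \<Sum>x \<in> {x \<in> U. \<pi> x = y}. \<sigma> x"
  have "\<bar>fibre_sum \<pi> U \<sigma> - fibre_sum \<pi> U \<sigma>'\<bar> \<le> (\<Sum>y \<in> \<pi> ` U. \<bar>\<bar>?s \<sigma> y\<bar> - \<bar>?s \<sigma>' y\<bar>\<bar>)"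
    unfolding fibre_sum_def sum_subtractf[symmetric] by (rule sum_abs)
  also have "\<dots> \<le> fibre_sum \<pi> U (\<lambda>x. \<sigma> x - \<sigma>' x)"
    unfolding fibre_sum_def sum_subtractf by (intro sum_mono abs_triangle_ineq3)
  also have "\<dots> \<le> (\<Sum>x \<in> U. \<bar>\<sigma> x - \<sigma>' x\<bar>)"
    by (rule fibre_sum_le_sum_abs[OF assms])
  finally show ?thesis .
qed

lemma sum_fibre_Un:
  assumes "finite A" "finite B" "A \<inter> B = {}"
  shows "(\<Sum>x \<in> {x \<in> A \<union> B. \<pi> x = y}. \<sigma> x)
    = (\<Sum>x \<in> {x \<in> A. \<pi> x = y}. \<sigma> x) + (\<Sum>x \<in> {x \<in> B. \<pi> x = y}. \<sigma> x)"
proof -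
  have "{x \<in> A \<union> B. \<pi> x = y} = {x \<in> A. \<pi> x = y} \<union> {x \<in> B. \<pi> x = y}" by auto
  then show ?thesis using assms by (simp add: sum.union_disjoint disjoint_iff)
qed

lemma fibre_sum_Un_le:
  assumes "finite A" "finite B" "A \<inter> B = {}"
  shows "fibre_sum \<pi> (A \<union> B) \<sigma> \<le> fibre_sum \<pi> A \<sigma> + fibre_sum \<pi> B \<sigma>"
proof -
  have "fibre_sum \<pi> S \<sigma> = (\<Sum>y \<in> \<pi> ` (A \<union> B). \<bar>\<Sum>x \<in> {x \<in> S. \<pi> x = y}. \<sigma> x\<bar>)" if "S \<subseteq> A \<union> B" for S
    using assms that by (intro fibre_sum_superset) auto
  from this[of A] this[of B] this[of "A \<union> B"] show ?thesis
    unfolding sum_fibre_Un[OF assms] by (simp add: sum_mono flip: sum.distrib)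
qed

lemma fibre_sum_Un:
  assumes "finite A" "finite B" "\<pi> ` A \<inter> \<pi> ` B = {}"
  shows "fibre_sum \<pi> (A \<union> B) \<sigma> = fibre_sum \<pi> A \<sigma> + fibre_sum \<pi> B \<sigma>"
proof -
  have "{x \<in> A \<union> B. \<pi> x = y} = {x \<in> A. \<pi> x = y}" if "y \<in> \<pi> ` A" for y
    using assms(3) that by auto
  moreover have "{x \<in> A \<union> B. \<pi> x = y} = {x \<in> B. \<pi> x = y}" if "y \<in> \<pi> ` B" for y
    using assms(3) that by auto
  ultimately show ?thesis
    using assms by (simp add: fibre_sum_def image_Un sum.union_disjoint)
qed

lemma sum_bool_sign_le_fibre_sum:
  assumes "finite U"
  shows "(\<Sum>x \<in> U. \<sigma> x * bool_sign (g (\<pi> x))) \<le> fibre_sum \<pi> U \<sigma>"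
proof -
  have "(\<Sum>x \<in> U. \<sigma> x * bool_sign (g (\<pi> x)))
      = (\<Sum>y \<in> \<pi> ` U. (\<Sum>x \<in> {x \<in> U. \<pi> x = y}. \<sigma> x) * bool_sign (g y))"
    unfolding sum.image_gen[OF assms, where g = \<pi>] sum_distrib_right by (intro sum.cong) auto
  also have "\<dots> \<le> fibre_sum \<pi> U \<sigma>"
    unfolding fibre_sum_def by (intro sum_mono) (auto simp: bool_sign_def)
  finally show ?thesis .
qed

lemma sum_bool_sign_majority_eq_fibre_sum:
  assumes "finite U"
  shows "(\<Sum>x \<in> U. \<sigma> x * bool_sign (0 < (\<Sum>z \<in> {z \<in> U. \<pi> z = \<pi> x}. \<sigma> z))) = fibre_sum \<pi> U \<sigma>"
proof -
  let ?s = "\<lambda>y. \<Sum>z \<in> {z \<in> U. \<pi> z = y}. \<sigma> z"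
  have "(\<Sum>x \<in> U. \<sigma> x * bool_sign (0 < ?s (\<pi> x))) = (\<Sum>y \<in> \<pi> ` U. ?s y * bool_sign (0 < ?s y))"
    unfolding sum.image_gen[OF assms, of _ \<pi>] sum_distrib_right by (intro sum.cong) auto
  also have "\<dots> = fibre_sum \<pi> U \<sigma>"
    unfolding fibre_sum_def by (intro sum.cong) (auto simp: bool_sign_def)
  finally show ?thesis .
qed

definition fibre_bias :: "('a \<Rightarrow> 'b) \<Rightarrow> ('a \<Rightarrow> 'c) \<Rightarrow> 'a set \<Rightarrow> 'c set \<Rightarrow> real" where
  "fibre_bias \<pi> h U G = fibre_sum \<pi> U (\<lambda>x. bool_sign (h x \<in> G))"

lemma fibre_bias_insert_diff_le:
  assumes "finite U" "card {x \<in> U. h x = y} \<le> M"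
  shows "\<bar>fibre_bias \<pi> h U (insert y G) - fibre_bias \<pi> h U G\<bar> \<le> 2 * real M"
proof -
  have "\<bar>fibre_bias \<pi> h U (insert y G) - fibre_bias \<pi> h U G\<bar>
      \<le> (\<Sum>x \<in> U. \<bar>bool_sign (h x \<in> insert y G) - bool_sign (h x \<in> G)\<bar>)"
    unfolding fibre_bias_def by (rule fibre_sum_diff_le[OF assms(1)])
  also have "\<dots> \<le> (\<Sum>x \<in> U. if h x = y then 2 else 0)"
    by (intro sum_mono) (auto simp: bool_sign_def)
  also have "\<dots> = 2 * real (card {x \<in> U. h x = y})"
    using assms(1) by (simp add: sum.If_cases Int_def)
  also have "\<dots> \<le> 2 * real M" using assms(2) by simp
  finally show ?thesis .
qed

lemma prob_fibre_bias_deviation_le: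
  assumes "finite U" "finite W" "\<And>y. y \<in> W \<Longrightarrow> card {x \<in> U. h x = y} \<le> M" "0 < \<delta>"
  shows "subset_prob W {G. \<delta> \<le> \<bar>fibre_bias \<pi> h U G - subset_expectation W (fibre_bias \<pi> h U)\<bar>}
    \<le> real (card W) * (real M)\<^sup>2 / \<delta>\<^sup>2"
  using subset_prob_deviation_le[OF assms(2), of "fibre_bias \<pi> h U" "2 * real M" \<delta>] assms
  by (simp add: fibre_bias_insert_diff_le power_mult_distrib)

lemma expectation_fibre_bias_id_le:
  assumes "finite U"
  shows "subset_expectation U (fibre_bias \<pi> (\<lambda>x. x) U) \<le> sqrt (card (\<pi> ` U) * card U)"
proof -
  let ?n = "\<lambda>y. card {x \<in> U. \<pi> x = y}"
  have "subset_expectation U (fibre_bias \<pi> (\<lambda>x. x) U) \<le> (\<Sum>y \<in> \<pi> ` U. sqrt (?n y))"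
    unfolding fibre_bias_def fibre_sum_def using assms
    by (simp add: sum_mono expectation_abs_sum_bool_sign_le)
  also have "\<dots> \<le> sqrt (card (\<pi> ` U) * card U)"
  proof (rule real_le_rsqrt)
    have "(\<Sum>y \<in> \<pi> ` U. sqrt (?n y))\<^sup>2 \<le> (\<Sum>y \<in> \<pi> ` U. (sqrt (?n y))\<^sup>2) * card (\<pi> ` U)"
      by (rule sum_squared_le_sum_of_squares)
    also have "(\<Sum>y \<in> \<pi> ` U. (sqrt (?n y))\<^sup>2) = card U"
      using sum.image_gen[OF assms, of "\<lambda>_. 1::real" \<pi>] by simp
    finally show "(\<Sum>y \<in> \<pi> ` U. sqrt (?n y))\<^sup>2 \<le> card (\<pi> ` U) * card U" by (simp add: mult.commute)
  qed
  finally show ?thesis .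
qed

lemma prob_fibre_bias_id_gt_le:
  assumes "finite U" "0 < w" "real (card (\<pi> ` U) * card U) \<le> w\<^sup>2"
  shows "subset_prob U {G. 2 * w < fibre_bias \<pi> (\<lambda>x. x) U G} \<le> card U / w\<^sup>2"
proof -
  let ?\<mu> = "subset_expectation U (fibre_bias \<pi> (\<lambda>x. x) U)"
  have "?\<mu> \<le> sqrt (w\<^sup>2)"
    using assms(3)
    by (intro order_trans[OF expectation_fibre_bias_id_le[OF assms(1)]] real_sqrt_le_mono) simp
  then have "?\<mu> \<le> w" using assms(2) by simp
  then have "subset_prob U {G. 2 * w < fibre_bias \<pi> (\<lambda>x. x) U G}
      \<le> subset_prob U {G. w \<le> \<bar>fibre_bias \<pi> (\<lambda>x. x) U G - ?\<mu>\<bar>}"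
    by (intro measure_pmf.finite_measure_mono) auto
  also have "\<dots> \<le> real (card U) * (real 1)\<^sup>2 / w\<^sup>2"
  proof (rule prob_fibre_bias_deviation_le[OF assms(1,1) _ assms(2)])
    show "card {x \<in> U. x = y} \<le> 1" for y
      using card_mono[of "{y}" "{x \<in> U. x = y}"] by auto
  qed
  finally show ?thesis by simp
qed

lemma expectation_fibre_bias_ge:
  assumes "finite U" "finite W" "h ` U \<subseteq> W"
    and "\<And>y. y \<in> \<pi> ` U \<Longrightarrow> card (h ` {x \<in> U. \<pi> x = y}) \<le> N"
  shows "card U / sqrt (3 * N) \<le> subset_expectation W (fibre_bias \<pi> h U)"
proof -
  have "card U / sqrt (3 * N) = (\<Sum>y \<in> \<pi> ` U. card {x \<in> U. \<pi> x = y} / sqrt (3 * N))"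
    using sum.image_gen[OF assms(1), of "\<lambda>_. 1::real" \<pi>] by (simp flip: sum_divide_distrib)
  also have "\<dots> \<le> (\<Sum>y \<in> \<pi> ` U. subset_expectation W
      (\<lambda>G. \<bar>\<Sum>x \<in> {x \<in> U. \<pi> x = y}. bool_sign (h x \<in> G)\<bar>))"
  proof (rule sum_mono)
    fix y assume y_in: "y \<in> \<pi> ` U"
    let ?F = "{x \<in> U. \<pi> x = y}"
    have "card ?F / sqrt (3 * N) \<le> card ?F / sqrt (3 * card (h ` ?F))"
      using assms(1) assms(4)[OF y_in] y_in by (intro frac_le) (auto simp: card_gt_0_iff)
    also have "\<dots> \<le> subset_expectation W (\<lambda>G. \<bar>\<Sum>x \<in> ?F. bool_sign (h x \<in> G)\<bar>)"
      using assms by (intro expectation_abs_sum_bool_sign_ge) auto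
    finally show "card ?F / sqrt (3 * N) \<le> \<dots>" .
  qed
  also have "\<dots> = subset_expectation W (fibre_bias \<pi> h U)"
    unfolding fibre_bias_def fibre_sum_def using assms(2) by simp
  finally show ?thesis by simp
qed

section \<open>Juntas and the distance on the cube\<close>

lemma finite_cube [simp]: "finite (cube n)"
  and card_cube: "card (cube n) = 2 ^ n"
proof -
  have "cube n = {xs :: bool list. set xs \<subseteq> UNIV \<and> length xs = n}"
    by (auto simp: cube_def)
  then show "finite (cube n)" "card (cube n) = 2 ^ n"
    using finite_lists_length_eq[of "UNIV :: bool set" n]
      card_lists_length_eq[of "UNIV :: bool set" n]
    by simp_all
qed

lemma cube_nonempty: "cube n \<noteq> {}"
  using card_cube[of n] by force

lemma sum_cube_split:
  assumes "m \<le> n"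
  shows "(\<Sum>x \<in> cube n. h x) = (\<Sum>z \<in> cube (n - m). \<Sum>y \<in> cube m. h (y @ z))"
proof -
  have "(\<Sum>x \<in> cube n. h x) = (\<Sum>(z, y) \<in> cube (n - m) \<times> cube m. h (y @ z))"
    by (rule sum.reindex_bij_witness[where i = "\<lambda>(z, y). y @ z" and j = "\<lambda>x. (drop m x, take m x)"])
       (use assms in \<open>auto simp: cube_def\<close>)
  then show ?thesis by (simp add: sum.cartesian_product)
qed

lemma distance_eq: "distance n f g = (\<Sum>x \<in> cube n. of_bool (f x \<noteq> g x)) / 2 ^ n"
  by (simp add: distance_def measure_pmf_of_set cube_nonempty card_cube sum.If_cases of_bool_def)

lemma distance_eq_correlation:
  "2 * distance n f g = 1 - (\<Sum>x \<in> cube n. bool_sign (f x) * bool_sign (g x)) / 2 ^ n"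
proof -
  have "(\<Sum>x \<in> cube n. bool_sign (f x) * bool_sign (g x))
      = (\<Sum>x \<in> cube n. 1 - 2 * of_bool (f x \<noteq> g x))"
    by (intro sum.cong) (auto simp: bool_sign_def)
  then show ?thesis
    by (simp add: distance_eq sum_subtractf card_cube diff_divide_distrib flip: sum_distrib_left)
qed

definition relevant_vars :: "nat \<Rightarrow> (bool list \<Rightarrow> bool) \<Rightarrow> nat set" where
  "relevant_vars n f = {i. i < n \<and> depends_on n f i}"

lemma relevant_vars_subset: "relevant_vars n f \<subseteq> {..<n}"
  by (auto simp: relevant_vars_def)

lemma finite_relevant_vars [simp]: "finite (relevant_vars n f)"
  by (simp add: relevant_vars_def)

lemma junta_iff: "junta n k f \<longleftrightarrow> card (relevant_vars n f) \<le> k"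
  by (simp add: junta_def relevant_vars_def)

lemma far_from_juntas_mono:
  "far_from_juntas n k' \<epsilon> f \<Longrightarrow> k \<le> k' \<Longrightarrow> far_from_juntas n k \<epsilon> f"
  by (auto simp: far_from_juntas_def junta_def)

lemma close_to_junta_self: "junta n k f \<Longrightarrow> 0 \<le> \<epsilon> \<Longrightarrow> close_to_junta n k \<epsilon> f"
  unfolding close_to_junta_def by (rule exI[of _ f]) (simp add: distance_eq)

lemma relevant_vars_const: "relevant_vars n (\<lambda>_. b) = {}"
  by (simp add: relevant_vars_def depends_on_def)

section \<open>Restricting a tester to fewer variables\<close>

lemma relevant_vars_append_subset:
  assumes "m \<le> n" "z \<in> cube (n - m)"
  shows "relevant_vars m (\<lambda>y. g (y @ z)) \<subseteq> relevant_vars n g"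
proof
  fix i assume "i \<in> relevant_vars m (\<lambda>y. g (y @ z))"
  then obtain y where y: "i < m" "y \<in> cube m" "g (y[i := \<not> y ! i] @ z) \<noteq> g (y @ z)"
    by (auto simp: relevant_vars_def depends_on_def)
  then have "y @ z \<in> cube n" "(y @ z)[i := \<not> (y @ z) ! i] = y[i := \<not> y ! i] @ z"
    using assms by (auto simp: cube_def list_update_append nth_append)
  with y assms(1) show "i \<in> relevant_vars n g"
    unfolding relevant_vars_def depends_on_def by (auto intro!: bexI[of _ "y @ z"])
qed

lemma relevant_vars_take_subset:
  assumes "m \<le> n"
  shows "relevant_vars n (\<lambda>x. g (take m x)) \<subseteq> relevant_vars m g"
proof
  fix i assume "i \<in> relevant_vars n (\<lambda>x. g (take m x))"
  then obtain x where x: "x \<in> cube n" "i < n" "g (take m (x[i := \<not> x ! i])) \<noteq> g (take m x)"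
    by (auto simp: relevant_vars_def depends_on_def)
  have "i < m"
    using x(3) by (rule contrapos_np) simp
  moreover have "take m x \<in> cube m" "take m (x[i := \<not> x ! i]) = (take m x)[i := \<not> take m x ! i]"
    using x \<open>i < m\<close> assms by (auto simp: cube_def take_update_swap)
  ultimately show "i \<in> relevant_vars m g"
    using x(3) unfolding relevant_vars_def depends_on_def by (auto intro!: bexI[of _ "take m x"])
qed

lemma distance_take:
  assumes "m \<le> n"
  shows "distance n (\<lambda>x. f (take m x)) g
      = (\<Sum>z \<in> cube (n - m). distance m f (\<lambda>y. g (y @ z))) / 2 ^ (n - m)"
proof -
  have "(\<Sum>x \<in> cube n. of_bool (f (take m x) \<noteq> g x))
      = (\<Sum>z \<in> cube (n - m). \<Sum>y \<in> cube m. of_bool (f y \<noteq> g (y @ z)) :: real)"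
    unfolding sum_cube_split[OF assms] by (intro sum.cong) (auto simp: cube_def)
  moreover have "(2 :: real) ^ n = 2 ^ m * 2 ^ (n - m)"
    using assms by (simp flip: power_add)
  ultimately show ?thesis
    by (simp add: distance_eq flip: sum_divide_distrib)
qed

lemma far_from_juntas_take:
  assumes "m \<le> n" "far_from_juntas m k \<epsilon> f"
  shows "far_from_juntas n k \<epsilon> (\<lambda>x. f (take m x))"
  unfolding far_from_juntas_def
proof (intro allI impI)
  fix g assume junta_g: "junta n k g"
  have "\<epsilon> \<le> distance m f (\<lambda>y. g (y @ z))" if "z \<in> cube (n - m)" for z
  proof -
    have "junta m k (\<lambda>y. g (y @ z))"
      using junta_g card_mono[OF _ relevant_vars_append_subset[OF assms(1) that, of g]]
      by (simp add: junta_iff)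
    then show ?thesis
      using assms(2) by (auto simp: far_from_juntas_def)
  qed
  then have "(\<Sum>z \<in> cube (n - m). \<epsilon>) \<le> (\<Sum>z \<in> cube (n - m). distance m f (\<lambda>y. g (y @ z)))"
    by (rule sum_mono)
  then show "\<epsilon> \<le> distance n (\<lambda>x. f (take m x)) g"
    by (simp add: distance_take[OF assms(1)] card_cube field_simps)
qed

lemma close_to_junta_take:
  assumes "m \<le> n" "close_to_junta m k \<epsilon> f"
  shows "close_to_junta n k \<epsilon> (\<lambda>x. f (take m x))"
proof -
  from assms(2) obtain g where junta_g: "junta m k g" and close_g: "distance m f g \<le> \<epsilon>"
    by (auto simp: close_to_junta_def)
  have "junta n k (\<lambda>x. g (take m x))"
    using junta_g card_mono[OF _ relevant_vars_take_subset[OF assms(1), of g]]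
    by (simp add: junta_iff)
  moreover have "distance m f (\<lambda>y. g (take m (y @ z))) = distance m f g" for z
    by (simp add: distance_eq cube_def)
  then have "distance n (\<lambda>x. f (take m x)) (\<lambda>x. g (take m x)) = distance m f g"
    by (simp add: distance_take[OF assms(1)] card_cube)
  ultimately show ?thesis using close_g unfolding close_to_junta_def by metis
qed

primrec map_queries :: "(bool list \<Rightarrow> bool list) \<Rightarrow> query_tree \<Rightarrow> query_tree" where
  "map_queries h (Answer b) = Answer b"
| "map_queries h (Query x t0 t1) = Query (h x) (map_queries h t0) (map_queries h t1)"

lemma accepts_map_queries: "accepts f (map_queries h t) = accepts (\<lambda>x. f (h x)) t"
  by (induction t) auto

lemma num_queries_map_queries: "num_queries f (map_queries h t) = num_queries (\<lambda>x. f (h x)) t"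
  by (induction t) auto

lemma queries_within_map_queries:
  "queries_within X t \<Longrightarrow> h ` X \<subseteq> Y \<Longrightarrow> queries_within Y (map_queries h t)"
  by (induction t) auto

lemma tolerant_junta_tester_take:
  assumes "m \<le> n" "tolerant_junta_tester n k \<epsilon>1 \<epsilon>2 T"
  shows "tolerant_junta_tester m k \<epsilon>1 \<epsilon>2 (map_pmf (map_queries (take m)) T)"
proof -
  have "take m ` cube n \<subseteq> cube m" using assms(1) by (auto simp: cube_def)
  then show ?thesis
    using assms(2) close_to_junta_take[OF assms(1)] far_from_juntas_take[OF assms(1)]
    by (auto simp: tolerant_junta_tester_def vimage_def accepts_map_queries
      intro!: queries_within_map_queries)
qed

lemma makes_at_most_map_queries:
  "makes_at_most q T \<Longrightarrow> makes_at_most q (map_pmf (map_queries h) T)"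
  by (auto simp: makes_at_most_def num_queries_map_queries)

section \<open>Distance to juntas via fibre sums\<close>

definition ones :: "bool list \<Rightarrow> nat set" where
  "ones x = {i. i < length x \<and> x ! i}"

lemma bij_betw_ones: "bij_betw ones (cube n) (Pow {..<n})"
proof (rule bij_betw_byWitness[where f' = "\<lambda>X. map (\<lambda>i. i \<in> X) [0..<n]"])
  show "\<forall>x \<in> cube n. map (\<lambda>i. i \<in> ones x) [0..<n] = x"
    by (auto simp: ones_def cube_def intro: nth_equalityI)
  show "\<forall>X \<in> Pow {..<n}. ones (map (\<lambda>i. i \<in> X) [0..<n]) = X"
    by (auto simp: ones_def)
qed (auto simp: ones_def cube_def)

lemma ones_subset: "x \<in> cube n \<Longrightarrow> ones x \<subseteq> {..<n}"
  by (auto simp: ones_def cube_def)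

lemma inj_on_ones: "inj_on ones (cube n)"
  using bij_betw_ones by (rule bij_betw_imp_inj_on)

lemma fibre_sum_cube:
  "fibre_sum (\<lambda>x. ones x \<inter> S) (cube n) (\<lambda>x. \<sigma> (ones x)) = fibre_sum (\<lambda>X. X \<inter> S) (Pow {..<n}) \<sigma>"
  using fibre_sum_image[OF inj_on_ones, of "\<lambda>X. X \<inter> S" n \<sigma>]
    bij_betw_imp_surj_on[OF bij_betw_ones, of n]
  by simp

lemma eq_if_agree_on_relevant_vars:
  assumes "x \<in> cube n" "y \<in> cube n" "\<And>i. i \<in> relevant_vars n g \<Longrightarrow> x ! i = y ! i"
  shows "g x = g y"
proof -
  have "g x = g y" if "finite E" "x \<in> cube n" "{i. i < n \<and> x ! i \<noteq> y ! i} \<subseteq> E"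
      "E \<subseteq> {..<n} - relevant_vars n g" for E x
    using that
  proof (induction E arbitrary: x rule: finite_induct)
    case empty
    then have "x = y" using assms(2) by (auto simp: cube_def intro: nth_equalityI)
    then show ?case by simp
  next
    case (insert i E)
    define x' where "x' = x[i := y ! i]"
    have "\<not> depends_on n g i"
      using insert.prems by (auto simp: relevant_vars_def)
    then have "g (x[i := \<not> x ! i]) = g x"
      using insert.prems by (auto simp: depends_on_def)
    moreover have "x' = x \<or> x' = x[i := \<not> x ! i]"
      unfolding x'_def by (cases "y ! i = x ! i") simp_all
    ultimately have "g x' = g x" by auto
    moreover have "g x' = g y"
      using insert.prems
      by (intro insert.IH) (auto simp: x'_def cube_def nth_list_update split: if_splits)
    ultimately show ?case by simp
  qed
  from this[of "{..<n} - relevant_vars n g" x] show ?thesis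
    using assms relevant_vars_subset by auto
qed

lemma far_from_juntas_if_fibre_sum_le:
  assumes "k \<le> n"
    and "\<And>S. S \<subseteq> {..<n} \<Longrightarrow> card S = k \<Longrightarrow>
      fibre_sum (\<lambda>x. ones x \<inter> S) (cube n) (\<lambda>x. bool_sign (f x)) \<le> (1 - 2 * \<epsilon>) * 2 ^ n"
  shows "far_from_juntas n k \<epsilon> f"
  unfolding far_from_juntas_def
proof (intro allI impI)
  fix g assume "junta n k g"
  then obtain S where S_covers: "relevant_vars n g \<subseteq> S" "S \<subseteq> {..<n}" "card S = k"
    using exists_subset_between[of "relevant_vars n g" k "{..<n}"] assms(1) relevant_vars_subset
    by (auto simp: junta_iff)
  define g' where "g' D = g (map (\<lambda>i. i \<in> D) [0..<n])" for D
  have "g x = g' (ones x \<inter> S)" if "x \<in> cube n" for x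
    unfolding g'_def
  proof (rule eq_if_agree_on_relevant_vars[OF that])
    show "x ! i = map (\<lambda>i. i \<in> ones x \<inter> S) [0..<n] ! i" if "i \<in> relevant_vars n g" for i
    proof -
      have "i \<in> S" "i < n" using that S_covers(1,2) by auto
      then show ?thesis using \<open>x \<in> cube n\<close> by (simp add: ones_def cube_def)
    qed
  qed (simp add: cube_def)
  then have "(\<Sum>x \<in> cube n. bool_sign (f x) * bool_sign (g x))
      = (\<Sum>x \<in> cube n. bool_sign (f x) * bool_sign (g' (ones x \<inter> S)))"
    by simp
  also have "\<dots> \<le> fibre_sum (\<lambda>x. ones x \<inter> S) (cube n) (\<lambda>x. bool_sign (f x))"
    by (rule sum_bool_sign_le_fibre_sum) simp
  also have "\<dots> \<le> (1 - 2 * \<epsilon>) * 2 ^ n"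
    by (rule assms(2)[OF S_covers(2,3)])
  finally have "(\<Sum>x \<in> cube n. bool_sign (f x) * bool_sign (g x)) / 2 ^ n \<le> 1 - 2 * \<epsilon>"
    by (simp add: field_simps)
  then show "\<epsilon> \<le> distance n f g"
    using distance_eq_correlation[of n f g] by linarith
qed

lemma close_to_junta_if_fibre_sum_ge:
  assumes "finite S" "card S \<le> k"
    and "(1 - 2 * \<epsilon>) * 2 ^ n \<le> fibre_sum (\<lambda>x. ones x \<inter> S) (cube n) (\<lambda>x. bool_sign (f x))"
  shows "close_to_junta n k \<epsilon> f"
proof -
  define g where "g x \<longleftrightarrow> 0 < (\<Sum>z \<in> {z \<in> cube n. ones z \<inter> S = ones x \<inter> S}. bool_sign (f z))" for x
  have "relevant_vars n g \<subseteq> S"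
  proof
    fix i assume relevant_i: "i \<in> relevant_vars n g"
    show "i \<in> S"
    proof (rule ccontr)
      assume "i \<notin> S"
      then have "ones (x[i := b]) \<inter> S = ones x \<inter> S" for x b
        by (auto simp: ones_def) (metis nth_list_update_neq)+
      then show False using relevant_i by (auto simp: relevant_vars_def depends_on_def g_def)
    qed
  qed
  then have "junta n k g"
    using assms(2) card_mono[OF assms(1)] by (auto simp: junta_iff intro: order_trans)
  moreover have "(\<Sum>x \<in> cube n. bool_sign (f x) * bool_sign (g x))
      = fibre_sum (\<lambda>x. ones x \<inter> S) (cube n) (\<lambda>x. bool_sign (f x))"
    unfolding g_def by (rule sum_bool_sign_majority_eq_fibre_sum) simp
  then have "1 - 2 * \<epsilon> \<le> (\<Sum>x \<in> cube n. bool_sign (f x) * bool_sign (g x)) / 2 ^ n"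
    using assms(3) by (simp add: field_simps)
  then have "distance n f g \<le> \<epsilon>"
    using distance_eq_correlation[of n f g] by linarith
  ultimately show ?thesis unfolding close_to_junta_def by blast
qed

section \<open>A random function is far from juntas\<close>

lemma fibre_sum_bool_sign_le_card_Diff_add:
  assumes "finite P" "U \<subseteq> P" "G \<subseteq> U"
  shows "fibre_sum \<pi> P (\<lambda>x. bool_sign (x \<in> G))
      \<le> real (card P) - real (card U) + fibre_bias \<pi> (\<lambda>x. x) U G"
proof -
  have finite_parts: "finite U" "finite (P - U)" using assms finite_subset by auto
  have "fibre_sum \<pi> ((P - U) \<union> U) (\<lambda>x. bool_sign (x \<in> G))
      \<le> fibre_sum \<pi> (P - U) (\<lambda>x. bool_sign (x \<in> G)) + fibre_bias \<pi> (\<lambda>x. x) U G"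
    unfolding fibre_bias_def using finite_parts by (intro fibre_sum_Un_le) auto
  also have "fibre_sum \<pi> (P - U) (\<lambda>x. bool_sign (x \<in> G)) \<le> real (card (P - U))"
    using fibre_sum_le_sum_abs[OF finite_parts(2)] by (rule order_trans) simp
  also have "real (card (P - U)) = real (card P) - real (card U)"
    using assms finite_parts by (simp add: card_Diff_subset card_mono of_nat_diff)
  finally show ?thesis using assms(2) by (simp add: Un_absorb2)
qed

lemma far_from_juntas_if_fibre_bias_le:
  assumes "k \<le> n" "U \<subseteq> Pow {..<n}" "G \<subseteq> U"
    and "\<And>S. S \<subseteq> {..<n} \<Longrightarrow> card S = k \<Longrightarrow>
      fibre_bias (\<lambda>X. X \<inter> S) (\<lambda>X. X) U G \<le> real (card U) - 2 * \<epsilon> * 2 ^ n"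
  shows "far_from_juntas n k \<epsilon> (\<lambda>x. ones x \<in> G)"
proof (rule far_from_juntas_if_fibre_sum_le[OF assms(1)])
  fix S assume S: "S \<subseteq> {..<n}" "card S = k"
  have "fibre_sum (\<lambda>X. X \<inter> S) (Pow {..<n}) (\<lambda>X. bool_sign (X \<in> G))
      \<le> 2 ^ n - real (card U) + fibre_bias (\<lambda>X. X \<inter> S) (\<lambda>X. X) U G"
    using fibre_sum_bool_sign_le_card_Diff_add[OF _ assms(2,3), of "\<lambda>X. X \<inter> S"]
    by (simp add: card_Pow)
  also have "\<dots> \<le> (1 - 2 * \<epsilon>) * 2 ^ n"
    using assms(4)[OF S] by (simp add: algebra_simps)
  finally show "fibre_sum (\<lambda>x. ones x \<inter> S) (cube n) (\<lambda>x. bool_sign (ones x \<in> G))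
      \<le> (1 - 2 * \<epsilon>) * 2 ^ n"
    by (subst fibre_sum_cube)
qed

lemma prob_fibre_bias_Int_gt_le:
  assumes "U \<subseteq> Pow {..<n}" "finite S"
  shows "subset_prob U {G. 2 * sqrt (2 ^ card S * 2 ^ n) < fibre_bias (\<lambda>X. X \<inter> S) (\<lambda>X. X) U G}
    \<le> 1 / 2 ^ card S"
proof -
  have "finite U" using assms(1) finite_subset by blast
  have card_U: "card U \<le> 2 ^ n" using card_mono[OF _ assms(1)] by (simp add: card_Pow)
  have "card ((\<lambda>X. X \<inter> S) ` U) \<le> card (Pow S)"
    using assms(2) by (intro card_mono) auto
  then have "real (card ((\<lambda>X. X \<inter> S) ` U)) * real (card U) \<le> 2 ^ card S * 2 ^ n"
    using card_U assms(2) by (intro mult_mono) (auto simp: card_Pow simp flip: of_nat_le_iff)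
  then have "subset_prob U {G. 2 * sqrt (2 ^ card S * 2 ^ n) < fibre_bias (\<lambda>X. X \<inter> S) (\<lambda>X. X) U G}
      \<le> card U / (sqrt (2 ^ card S * 2 ^ n))\<^sup>2"
    by (intro prob_fibre_bias_id_gt_le \<open>finite U\<close>) simp_all
  also have "\<dots> \<le> 1 / 2 ^ card S"
    using card_U by (simp add: field_simps flip: of_nat_le_iff)
  finally show ?thesis .
qed

lemma prob_not_far_from_juntas_le:
  assumes "U \<subseteq> Pow {..<n}" "k \<le> n"
    and gap: "2 * sqrt (2 ^ k * 2 ^ n) \<le> real (card U) - 2 * \<epsilon> * 2 ^ n"
  shows "subset_prob U {G. \<not> far_from_juntas n k \<epsilon> (\<lambda>x. ones x \<in> G)} \<le> real (n choose k) / 2 ^ k"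
proof -
  define \<S> where "\<S> = {S. S \<subseteq> {..<n} \<and> card S = k}"
  define biased where
    "biased S = {G. 2 * sqrt (2 ^ k * 2 ^ n) < fibre_bias (\<lambda>X. X \<inter> S) (\<lambda>X. X) U G}" for S
  have "finite U" using assms(1) finite_subset by blast
  have "finite \<S>" by (auto simp: \<S>_def)
  have "G \<in> (\<Union>S \<in> \<S>. biased S)" if "G \<subseteq> U" "\<not> far_from_juntas n k \<epsilon> (\<lambda>x. ones x \<in> G)" for G
  proof (rule ccontr)
    assume unbiased: "G \<notin> (\<Union>S \<in> \<S>. biased S)"
    have "far_from_juntas n k \<epsilon> (\<lambda>x. ones x \<in> G)"
    proof (rule far_from_juntas_if_fibre_bias_le[OF assms(2,1) that(1)])
      fix S assume "S \<subseteq> {..<n}" "card S = k"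
      then have "fibre_bias (\<lambda>X. X \<inter> S) (\<lambda>X. X) U G \<le> 2 * sqrt (2 ^ k * 2 ^ n)"
        using unbiased by (auto simp: \<S>_def biased_def not_less)
      then show "fibre_bias (\<lambda>X. X \<inter> S) (\<lambda>X. X) U G \<le> real (card U) - 2 * \<epsilon> * 2 ^ n"
        using gap by linarith
    qed
    with that(2) show False by contradiction
  qed
  then have "subset_prob U {G. \<not> far_from_juntas n k \<epsilon> (\<lambda>x. ones x \<in> G)}
      \<le> subset_prob U (\<Union>S \<in> \<S>. biased S)"
    by (intro subset_prob_mono \<open>finite U\<close>) simp
  also have "\<dots> \<le> (\<Sum>S \<in> \<S>. subset_prob U (biased S))"
    using \<open>finite \<S>\<close> by (intro measure_pmf.finite_measure_subadditive_finite) auto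
  also have "\<dots> \<le> (\<Sum>S \<in> \<S>. 1 / 2 ^ k)"
  proof (rule sum_mono)
    fix S assume "S \<in> \<S>"
    then have "finite S" "card S = k" using finite_subset by (auto simp: \<S>_def)
    then show "subset_prob U (biased S) \<le> 1 / 2 ^ k"
      using prob_fibre_bias_Int_gt_le[OF assms(1), of S] by (simp add: biased_def)
  qed
  also have "\<dots> = real (n choose k) / 2 ^ k"
    using n_subsets[of "{..<n}" k] by (simp add: \<S>_def)
  finally show ?thesis .
qed

section \<open>Distinguishing random functions by decision trees\<close>

lemma pmf_bind_ge:
  assumes "a \<ge> 0"
  shows "measure_pmf.prob P {x. a \<le> pmf (F x) b} * a \<le> pmf (bind_pmf P F) b"
proof -
  have "measure_pmf.prob P {x. a \<le> pmf (F x) b} * a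
      = measure_pmf.expectation P (\<lambda>x. indicator {x. a \<le> pmf (F x) b} x * a)"
    by simp
  also have "\<dots> \<le> measure_pmf.expectation P (\<lambda>x. pmf (F x) b)"
    using assms
    by (intro integral_mono measure_pmf.integrable_const_bound[where B = 1] integrable_mult_left)
       (auto simp: pmf_le_1 split: split_indicator)
  finally show ?thesis by (simp add: pmf_bind)
qed

lemma pmf_bind_mono:
  assumes "\<And>x. x \<in> set_pmf T \<Longrightarrow> c * pmf (F x) b \<le> pmf (G x) b"
  shows "c * pmf (bind_pmf T F) b \<le> pmf (bind_pmf T G) b"
proof -
  have integrable: "integrable (measure_pmf T) (\<lambda>x. pmf (F x) b)" for F :: "'a \<Rightarrow> 'b pmf"
    by (rule measure_pmf.integrable_const_bound[where B = 1]) (auto simp: pmf_le_1)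
  have "c * pmf (bind_pmf T F) b = measure_pmf.expectation T (\<lambda>x. c * pmf (F x) b)"
    by (simp add: pmf_bind)
  also have "\<dots> \<le> pmf (bind_pmf T G) b"
    unfolding pmf_bind using assms
    by (intro integral_mono_AE integrable integrable_mult_right) (auto simp: AE_measure_pmf_iff)
  finally show ?thesis .
qed

lemma pmf_map_mono:
  assumes "\<And>x. c * pmf p x \<le> pmf q x" "0 \<le> c"
  shows "c * pmf (map_pmf h p) b \<le> pmf (map_pmf h q) b"
proof -
  have "c * infsetsum (pmf p) A \<le> infsetsum (pmf q) A" for A
    unfolding infsetsum_cmult_right[OF pmf_abs_summable, symmetric]
    using assms by (intro infsetsum_mono abs_summable_on_cmult_right pmf_abs_summable)
  then show ?thesis
    by (simp add: pmf_map measure_pmf_conv_infsetsum)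
qed

lemma prob_bind_pmf_ge:
  assumes "\<And>x. x \<in> set_pmf P \<Longrightarrow> p \<le> measure_pmf.prob (F x) S"
  shows "p \<le> measure_pmf.prob (bind_pmf P F) S"
proof -
  have prob: "measure_pmf.prob D S = pmf (map_pmf (\<lambda>x. x \<in> S) D) True" for D
    by (simp add: pmf_map vimage_def)
  have "p * pmf (bind_pmf P (\<lambda>_. return_pmf True)) True
      \<le> pmf (map_pmf (\<lambda>x. x \<in> S) (bind_pmf P F)) True"
    unfolding map_bind_pmf using assms by (intro pmf_bind_mono) (simp add: prob)
  then show ?thesis by (simp add: prob)
qed

definition answer_pmf :: "(bool list \<Rightarrow> bool) pmf \<Rightarrow> query_tree pmf \<Rightarrow> bool pmf" where
  "answer_pmf P T = bind_pmf P (\<lambda>f. map_pmf (accepts f) T)"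

lemma answer_pmf_commute: "answer_pmf P T = bind_pmf T (\<lambda>t. map_pmf (\<lambda>f. accepts f t) P)"
  unfolding answer_pmf_def map_pmf_def by (rule bind_commute_pmf)

lemma pmf_answer_pmf_ge:
  assumes "p \<le> measure_pmf.prob P S" "0 \<le> a"
    and "\<And>f. f \<in> S \<Longrightarrow> a \<le> measure_pmf.prob T {t. accepts f t = b}"
  shows "p * a \<le> pmf (answer_pmf P T) b"
proof -
  have "S \<subseteq> {f. a \<le> pmf (map_pmf (accepts f) T) b}"
    using assms(3) by (auto simp: pmf_map vimage_def)
  then have "measure_pmf.prob P S \<le> measure_pmf.prob P {f. a \<le> pmf (map_pmf (accepts f) T) b}"
    by (intro measure_pmf.finite_measure_mono) auto
  with assms(1,2) have "p * a \<le> measure_pmf.prob P {f. a \<le> pmf (map_pmf (accepts f) T) b} * a"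
    by (intro mult_right_mono) auto
  also have "\<dots> \<le> pmf (answer_pmf P T) b"
    unfolding answer_pmf_def by (rule pmf_bind_ge[OF assms(2)])
  finally show ?thesis .
qed

lemma Yao_tolerant_junta_tester:
  assumes tester: "tolerant_junta_tester n k \<epsilon>1 \<epsilon>2 T"
    and far: "p \<le> measure_pmf.prob P {f. far_from_juntas n k \<epsilon>2 f}"
    and close: "p \<le> measure_pmf.prob Q {f. close_to_junta n k \<epsilon>1 f}"
    and "0 \<le> c"
    and indistinguishable: "\<And>t. t \<in> set_pmf T \<Longrightarrow>
      c * pmf (map_pmf (\<lambda>f. accepts f t) P) False \<le> pmf (map_pmf (\<lambda>f. accepts f t) Q) False"
  shows "c * (p * (2 / 3)) \<le> 1 - p * (2 / 3)"
proof -
  have "p * (2 / 3) \<le> pmf (answer_pmf P T) False"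
    using tester by (intro pmf_answer_pmf_ge[OF far]) (simp_all add: tolerant_junta_tester_def)
  then have "c * (p * (2 / 3)) \<le> c * pmf (answer_pmf P T) False"
    using \<open>0 \<le> c\<close> by (rule mult_left_mono)
  also have "\<dots> \<le> pmf (answer_pmf Q T) False"
    unfolding answer_pmf_commute by (rule pmf_bind_mono[OF indistinguishable])
  finally have "c * (p * (2 / 3)) \<le> 1 - pmf (answer_pmf Q T) True"
    by (simp add: pmf_False_conv_True)
  moreover have "p * (2 / 3) \<le> pmf (answer_pmf Q T) True"
    using tester by (intro pmf_answer_pmf_ge[OF close]) (simp_all add: tolerant_junta_tester_def)
  ultimately show ?thesis by linarith
qed

primrec transcript :: "(bool list \<Rightarrow> bool) \<Rightarrow> query_tree \<Rightarrow> (bool list \<times> bool) list" where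
  "transcript f (Answer b) = []"
| "transcript f (Query x t0 t1) = (x, f x) # (if f x then transcript f t1 else transcript f t0)"

definition queried :: "(bool list \<Rightarrow> bool) \<Rightarrow> query_tree \<Rightarrow> bool list set" where
  "queried f t = fst ` set (transcript f t)"

primrec replay :: "query_tree \<Rightarrow> (bool list \<times> bool) list \<Rightarrow> bool" where
  "replay (Answer b) \<tau> = b"
| "replay (Query x t0 t1) \<tau> = (if snd (hd \<tau>) then replay t1 (tl \<tau>) else replay t0 (tl \<tau>))"

lemma replay_transcript: "replay t (transcript f t) = accepts f t"
  by (induction t) auto

lemma transcript_eq_iff: "transcript g t = transcript f t \<longleftrightarrow> (\<forall>x \<in> queried f t. g x = f x)"
  by (induction t) (auto simp: queried_def)

lemma finite_queried: "finite (queried f t)"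
  by (simp add: queried_def)

lemma card_queried_le: "card (queried f t) \<le> num_queries f t"
proof -
  have "length (transcript f t) = num_queries f t" by (induction t) auto
  moreover have "card (queried f t) \<le> length (transcript f t)"
    unfolding queried_def set_map[symmetric] by (metis card_length length_map)
  ultimately show ?thesis by simp
qed

lemma queried_subset: "queries_within X t \<Longrightarrow> queried f t \<subseteq> X"
  by (induction t) (auto simp: queried_def)

definition random_function :: "(bool list \<Rightarrow> 'k) \<Rightarrow> 'k set \<Rightarrow> (bool list \<Rightarrow> bool) pmf" where
  "random_function K U = map_pmf (\<lambda>G x. K x \<in> G) (random_subset U)"

lemma pmf_transcript_random_function:
  assumes "finite U" "inj_on K {x \<in> queried f t. K x \<in> U}"
    and "\<And>x. x \<in> queried f t \<Longrightarrow> f x \<Longrightarrow> K x \<in> U"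
  shows "pmf (map_pmf (\<lambda>f. transcript f t) (random_function K U)) (transcript f t)
    = (1 / 2) ^ card {x \<in> queried f t. K x \<in> U}"
proof -
  define D where "D = {x \<in> queried f t. K x \<in> U}"
  define v where "v y = f (the_inv_into D K y)" for y
  have v_key: "v (K x) = f x" if "x \<in> D" for x
    using that assms(2) by (simp add: v_def D_def the_inv_into_f_f)
  have "transcript (\<lambda>x. K x \<in> G) t = transcript f t \<longleftrightarrow> (\<forall>y \<in> K ` D. (y \<in> G) = v y)"
    if "G \<in> Pow U" for G
    using that assms(3) v_key unfolding transcript_eq_iff by (auto simp: D_def)
  then have "pmf (map_pmf (\<lambda>f. transcript f t) (random_function K U)) (transcript f t)
      = subset_prob U {G. \<forall>y \<in> K ` D. (y \<in> G) = v y}"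
    unfolding random_function_def pmf.map_comp comp_def pmf_map using assms(1)
    by (intro measure_pmf.finite_measure_eq_AE) (auto simp: AE_measure_pmf_iff Pow_not_empty)
  also have "\<dots> = (1 / 2) ^ card (K ` D)"
    by (rule subset_prob_agree[OF assms(1)]) (auto simp: D_def)
  finally show ?thesis
    using card_image[OF assms(2)] by (simp add: D_def)
qed

lemma prob_inj_on_ge:
  fixes K :: "'p \<Rightarrow> 'x \<Rightarrow> 'k"
  assumes "finite D" "card D \<le> q" "0 \<le> \<beta>"
    and "\<And>x y. x \<in> D \<Longrightarrow> y \<in> D \<Longrightarrow> x \<noteq> y \<Longrightarrow> measure_pmf.prob \<Phi> {\<phi>. K \<phi> x = K \<phi> y} \<le> \<beta>"
  shows "1 - real (q * (q - 1)) * \<beta> \<le> measure_pmf.prob \<Phi> {\<phi>. inj_on (K \<phi>) D}"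
proof -
  define pairs where "pairs = (SIGMA x : D. D - {x})"
  have "{\<phi>. \<not> inj_on (K \<phi>) D} \<subseteq> (\<Union>(x, y) \<in> pairs. {\<phi>. K \<phi> x = K \<phi> y})"
    by (auto simp: inj_on_def pairs_def)
  then have "measure_pmf.prob \<Phi> {\<phi>. \<not> inj_on (K \<phi>) D}
      \<le> measure_pmf.prob \<Phi> (\<Union>(x, y) \<in> pairs. {\<phi>. K \<phi> x = K \<phi> y})"
    by (intro measure_pmf.finite_measure_mono) auto
  also have "\<dots> \<le> (\<Sum>(x, y) \<in> pairs. measure_pmf.prob \<Phi> {\<phi>. K \<phi> x = K \<phi> y})"
    using assms(1)
      measure_pmf.finite_measure_subadditive_finite[of pairs "\<lambda>(x, y). {\<phi>. K \<phi> x = K \<phi> y}" \<Phi>]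
    by (simp add: pairs_def case_prod_unfold)
  also have "\<dots> \<le> (\<Sum>p \<in> pairs. \<beta>)"
    by (intro sum_mono) (use assms(4) in \<open>auto simp: pairs_def\<close>)
  also have "\<dots> = real (card D * (card D - 1)) * \<beta>"
    using assms(1) by (simp add: pairs_def card_Diff_singleton)
  also have "\<dots> \<le> real (q * (q - 1)) * \<beta>"
    using assms(2,3) by (intro mult_right_mono) (auto intro!: mult_le_mono simp flip: of_nat_mult)
  finally have "measure_pmf.prob \<Phi> {\<phi>. \<not> inj_on (K \<phi>) D} \<le> real (q * (q - 1)) * \<beta>" .
  then show ?thesis
    using measure_pmf.prob_neg[of \<Phi> "\<lambda>\<phi>. inj_on (K \<phi>) D"] by simp
qed

text \<open>
  Conditioning on a whole transcript makes adaptivity harmless: the points that are queried are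
  then fixed, and a transcript is as likely for \<open>K \<phi>\<close> as for \<open>K0\<close> unless \<open>K \<phi>\<close> identifies two of
  them.
\<close>
lemma pmf_transcript_random_function_le:
  fixes K0 :: "bool list \<Rightarrow> 'k" and K :: "'p \<Rightarrow> bool list \<Rightarrow> 'k"
  assumes "finite U" "queries_within X t" "num_queries f t \<le> q" "inj_on K0 X" "0 \<le> \<beta>"
    and mem_iff: "\<And>\<phi> x. \<phi> \<in> set_pmf \<Phi> \<Longrightarrow> x \<in> X \<Longrightarrow> K \<phi> x \<in> U \<longleftrightarrow> K0 x \<in> U"
    and collision: "\<And>x y. x \<in> X \<Longrightarrow> y \<in> X \<Longrightarrow> x \<noteq> y \<Longrightarrow> measure_pmf.prob \<Phi> {\<phi>. K \<phi> x = K \<phi> y} \<le> \<beta>"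
    and support: "\<And>x. x \<in> queried f t \<Longrightarrow> f x \<Longrightarrow> K0 x \<in> U"
  shows "(1 - real (q * (q - 1)) * \<beta>)
      * pmf (map_pmf (\<lambda>f. transcript f t) (random_function K0 U)) (transcript f t)
    \<le> pmf (map_pmf (\<lambda>f. transcript f t) (bind_pmf \<Phi> (\<lambda>\<phi>. random_function (K \<phi>) U)))
      (transcript f t)"
proof -
  define D where "D = {x \<in> queried f t. K0 x \<in> U}"
  let ?tr = "\<lambda>K. map_pmf (\<lambda>f. transcript f t) (random_function K U)"
  have queried: "queried f t \<subseteq> X" by (rule queried_subset[OF assms(2)])
  have "finite D" "D \<subseteq> X" using finite_queried queried by (auto simp: D_def)
  have "card D \<le> card (queried f t)" by (intro card_mono finite_queried) (auto simp: D_def)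
  also have "\<dots> \<le> q" by (rule order_trans[OF card_queried_le assms(3)])
  finally have inj: "1 - real (q * (q - 1)) * \<beta> \<le> measure_pmf.prob \<Phi> {\<phi>. inj_on (K \<phi>) D}"
    using \<open>D \<subseteq> X\<close> assms(5) by (intro prob_inj_on_ge[OF \<open>finite D\<close>] collision) auto
  have "pmf (?tr (K \<phi>)) (transcript f t) = (1 / 2) ^ card D"
    if "\<phi> \<in> set_pmf \<Phi>" "inj_on (K \<phi>) D" for \<phi>
  proof -
    have "{x \<in> queried f t. K \<phi> x \<in> U} = D"
      using mem_iff[OF that(1)] queried by (auto simp: D_def)
    then show ?thesis
      using pmf_transcript_random_function[OF assms(1), of "K \<phi>" f t]
        mem_iff[OF that(1)] that(2) queried support by auto
  qed
  then have "measure_pmf.prob \<Phi> {\<phi>. inj_on (K \<phi>) D}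
      \<le> measure_pmf.prob \<Phi> {\<phi>. (1 / 2) ^ card D \<le> pmf (?tr (K \<phi>)) (transcript f t)}"
    by (intro measure_pmf.finite_measure_mono_AE) (auto simp: AE_measure_pmf_iff)
  with inj have "(1 - real (q * (q - 1)) * \<beta>) * (1 / 2) ^ card D
      \<le> measure_pmf.prob \<Phi> {\<phi>. (1 / 2) ^ card D \<le> pmf (?tr (K \<phi>)) (transcript f t)}
        * (1 / 2) ^ card D"
    by (intro mult_right_mono) auto
  also have "\<dots> \<le> pmf (bind_pmf \<Phi> (\<lambda>\<phi>. ?tr (K \<phi>))) (transcript f t)"
    by (rule pmf_bind_ge) simp
  also have "(1 / 2) ^ card D = pmf (?tr K0) (transcript f t)"
    unfolding D_def using assms(1,4) queried support
    by (intro pmf_transcript_random_function[symmetric]) (auto intro: inj_on_subset)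
  finally show ?thesis unfolding map_bind_pmf .
qed

lemma pmf_accepts_random_function_le:
  fixes K0 :: "bool list \<Rightarrow> 'k" and K :: "'p \<Rightarrow> bool list \<Rightarrow> 'k"
  assumes "finite U" "queries_within X t" "\<And>f. num_queries f t \<le> q" "inj_on K0 X" "0 \<le> \<beta>"
    and "\<And>\<phi> x. \<phi> \<in> set_pmf \<Phi> \<Longrightarrow> x \<in> X \<Longrightarrow> K \<phi> x \<in> U \<longleftrightarrow> K0 x \<in> U"
    and "\<And>x y. x \<in> X \<Longrightarrow> y \<in> X \<Longrightarrow> x \<noteq> y \<Longrightarrow> measure_pmf.prob \<Phi> {\<phi>. K \<phi> x = K \<phi> y} \<le> \<beta>"
    and "real (q * (q - 1)) * \<beta> \<le> 1"
  shows "(1 - real (q * (q - 1)) * \<beta>) * pmf (map_pmf (\<lambda>f. accepts f t) (random_function K0 U)) b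
    \<le> pmf (map_pmf (\<lambda>f. accepts f t) (bind_pmf \<Phi> (\<lambda>\<phi>. random_function (K \<phi>) U))) b"
proof -
  let ?tr = "map_pmf (\<lambda>f. transcript f t)"
  have transcript: "(1 - real (q * (q - 1)) * \<beta>) * pmf (?tr (random_function K0 U)) \<tau>
      \<le> pmf (?tr (bind_pmf \<Phi> (\<lambda>\<phi>. random_function (K \<phi>) U))) \<tau>" for \<tau>
  proof (cases "\<tau> \<in> set_pmf (?tr (random_function K0 U))")
    case True
    then obtain G where "G \<subseteq> U" and \<tau>: "\<tau> = transcript (\<lambda>x. K0 x \<in> G) t"
      using assms(1) by (auto simp: random_function_def Pow_not_empty)
    then show ?thesis
      unfolding \<tau> by (intro pmf_transcript_random_function_le[where X = X] assms) auto
  next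
    case False
    then have "pmf (?tr (random_function K0 U)) \<tau> = 0"
      by (simp only: pmf_eq_0_set_pmf not_False_eq_True)
    then show ?thesis by simp
  qed
  have "map_pmf (\<lambda>f. accepts f t) D = map_pmf (replay t) (?tr D)" for D
    by (simp add: pmf.map_comp comp_def replay_transcript)
  then show ?thesis
    using pmf_map_mono[OF transcript] assms(8) by simp
qed

lemma tolerant_junta_tester_collision_bound:
  fixes K0 :: "bool list \<Rightarrow> 'k" and K :: "'p \<Rightarrow> bool list \<Rightarrow> 'k"
  assumes tester: "tolerant_junta_tester n k \<epsilon>1 \<epsilon>2 T" and bounded: "makes_at_most q T"
    and "finite U" "inj_on K0 (cube n)" "0 \<le> \<beta>"
    and "\<And>\<phi> x. \<phi> \<in> set_pmf \<Phi> \<Longrightarrow> x \<in> cube n \<Longrightarrow> K \<phi> x \<in> U \<longleftrightarrow> K0 x \<in> U"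
    and "\<And>x y. x \<in> cube n \<Longrightarrow> y \<in> cube n \<Longrightarrow> x \<noteq> y \<Longrightarrow> measure_pmf.prob \<Phi> {\<phi>. K \<phi> x = K \<phi> y} \<le> \<beta>"
    and far: "9 / 10 \<le> measure_pmf.prob (random_function K0 U) {f. far_from_juntas n k \<epsilon>2 f}"
    and close: "\<And>\<phi>. \<phi> \<in> set_pmf \<Phi> \<Longrightarrow>
      9 / 10 \<le> measure_pmf.prob (random_function (K \<phi>) U) {f. close_to_junta n k \<epsilon>1 f}"
  shows "1 \<le> 3 * real (q * (q - 1)) * \<beta>"
proof -
  define \<delta> where "\<delta> = real (q * (q - 1)) * \<beta>"
  have "1 \<le> 3 * \<delta>"
  proof (cases "\<delta> \<le> 1")
    case True
    let ?Q = "bind_pmf \<Phi> (\<lambda>\<phi>. random_function (K \<phi>) U)"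
    have "(1 - \<delta>) * (9 / 10 * (2 / 3)) \<le> 1 - 9 / 10 * (2 / 3)"
    proof (rule Yao_tolerant_junta_tester[OF tester far prob_bind_pmf_ge[OF close]])
      show "(1 - \<delta>) * pmf (map_pmf (\<lambda>f. accepts f t) (random_function K0 U)) False
          \<le> pmf (map_pmf (\<lambda>f. accepts f t) ?Q) False" if "t \<in> set_pmf T" for t
        using tester bounded that True unfolding tolerant_junta_tester_def makes_at_most_def \<delta>_def
        by (intro pmf_accepts_random_function_le[where X = "cube n"] assms(3-7)) blast+
    qed (use True in simp_all)
    then show ?thesis by simp
  qed simp
  then show ?thesis by (simp only: \<delta>_def mult.assoc)
qed

section \<open>Collapsing hidden blocks\<close>

text \<open>
  \<open>A\<close> is a disjoint union of blocks, and \<open>ld\<close> sends each element of \<open>A\<close> to the leader of its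
  block.  The map \<open>collapse\<close> below identifies exactly the sets that differ by a union of blocks.
\<close>
locale blocks =
  fixes V A :: "'a set" and ld :: "'a \<Rightarrow> 'a"
  assumes finite_V: "finite V" and A_subset: "A \<subseteq> V"
    and ld_in: "p \<in> A \<Longrightarrow> ld p \<in> A" and ld_ld: "p \<in> A \<Longrightarrow> ld (ld p) = ld p"
begin

definition collapse :: "'a set \<Rightarrow> 'a set" where
  "collapse X = (X - A) \<union> {p \<in> A. (p \<in> X) \<noteq> (ld p \<in> X)}"

lemma finite_A: "finite A"
  using finite_subset[OF A_subset finite_V] .

lemma leaders_subset: "ld ` A \<subseteq> A"
  using ld_in by auto

lemma collapse_Diff: "collapse X - A = X - A"
  by (auto simp: collapse_def)

lemma collapse_subset: "X \<subseteq> V \<Longrightarrow> collapse X \<subseteq> V"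
  using A_subset by (auto simp: collapse_def)

lemma collapse_Int_leaders: "collapse X \<inter> ld ` A = {}"
  using ld_in ld_ld by (auto simp: collapse_def)

lemma collapse_eq_iff:
  "collapse X = collapse Y \<longleftrightarrow>
    X - A = Y - A \<and> (\<forall>p \<in> A. p \<in> sym_diff X Y \<longleftrightarrow> ld p \<in> sym_diff X Y)"
proof -
  have "collapse X = collapse Y \<longleftrightarrow> X - A = Y - A
      \<and> (\<forall>p \<in> A. ((p \<in> X) \<noteq> (ld p \<in> X)) = ((p \<in> Y) \<noteq> (ld p \<in> Y)))"
    unfolding collapse_def by blast
  moreover have "((p \<in> X) \<noteq> (ld p \<in> X)) = ((p \<in> Y) \<noteq> (ld p \<in> Y))
      \<longleftrightarrow> (p \<in> sym_diff X Y \<longleftrightarrow> ld p \<in> sym_diff X Y)" for p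
    by blast
  ultimately show ?thesis by (simp only:)
qed

lemma collapse_eq_imp_ex_block:
  assumes "collapse X = collapse Y" "X \<noteq> Y"
  shows "\<exists>p \<in> A. {r \<in> A. ld r = ld p} \<subseteq> sym_diff X Y"
proof -
  define D where "D = sym_diff X Y"
  have D_leader: "p \<in> D \<longleftrightarrow> ld p \<in> D" if "p \<in> A" for p
    using assms(1) that unfolding collapse_eq_iff D_def by blast
  have "X - A = Y - A" using assms(1) unfolding collapse_eq_iff by blast
  then obtain p where p: "p \<in> A" "p \<in> D" using assms(2) unfolding D_def by blast
  then have "{r \<in> A. ld r = ld p} \<subseteq> D" using D_leader by auto
  then show ?thesis using p(1) unfolding D_def by blast
qed

lemma card_collapse_preimage_le:
  assumes "U \<subseteq> Pow V"
  shows "card {X \<in> U. collapse X = Y} \<le> 2 ^ card (ld ` A)"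
proof -
  have "inj_on (\<lambda>X. X \<inter> ld ` A) {X \<in> U. collapse X = Y}"
  proof (intro inj_onI, rule ccontr)
    fix X Z assume "X \<in> {X \<in> U. collapse X = Y}" "Z \<in> {X \<in> U. collapse X = Y}"
      and leaders: "X \<inter> ld ` A = Z \<inter> ld ` A" and "X \<noteq> Z"
    then obtain p where p: "p \<in> A" "{r \<in> A. ld r = ld p} \<subseteq> sym_diff X Z"
      using collapse_eq_imp_ex_block[of X Z] by auto
    then have "ld p \<in> sym_diff X Z" using ld_in ld_ld by blast
    then show False using leaders p(1) by blast
  qed
  then have "card {X \<in> U. collapse X = Y} \<le> card (Pow (ld ` A))"
    using finite_A by (intro card_inj_on_le[where f = "\<lambda>X. X \<inter> ld ` A"]) auto
  then show ?thesis using finite_A by (simp add: card_Pow)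
qed

lemma card_collapse_fibre_le:
  "card (collapse ` {X \<in> U. X - A = D}) \<le> 2 ^ (card A - card (ld ` A))"
proof -
  have "collapse ` {X \<in> U. X - A = D} \<subseteq> (\<union>) D ` Pow (A - ld ` A)"
  proof (intro image_subsetI)
    fix X assume "X \<in> {X \<in> U. X - A = D}"
    then have "collapse X = D \<union> (collapse X \<inter> (A - ld ` A))"
      using collapse_Diff[of X] collapse_Int_leaders[of X] by blast
    then show "collapse X \<in> (\<union>) D ` Pow (A - ld ` A)" by blast
  qed
  then have "card (collapse ` {X \<in> U. X - A = D}) \<le> card (Pow (A - ld ` A))"
    using finite_A by (intro surj_card_le) auto
  also have "\<dots> = 2 ^ (card A - card (ld ` A))"
    using finite_A leaders_subset by (simp add: card_Pow card_Diff_subset)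
  finally show ?thesis .
qed

end

locale blocks_on = blocks +
  fixes U :: "'a set set"
  assumes U_subset: "U \<subseteq> Pow V"
    and U_invariant: "X \<in> U \<Longrightarrow> Y \<subseteq> V \<Longrightarrow> X - A = Y - A \<Longrightarrow> Y \<in> U"
begin

lemma finite_U: "finite U"
  using finite_subset[OF U_subset] finite_V by simp

lemma collapse_mem_iff:
  assumes "X \<subseteq> V"
  shows "collapse X \<in> U \<longleftrightarrow> X \<in> U"
  using U_invariant[of "collapse X" X] U_invariant[of X "collapse X"] collapse_Diff[of X]
    collapse_subset[OF assms] assms by metis

lemma fibre_sum_collapse:
  assumes "G \<subseteq> U"
  shows "fibre_sum (\<lambda>X. X - A) (Pow V) (\<lambda>X. bool_sign (collapse X \<in> G))
    = 2 ^ card V - real (card U) + fibre_bias (\<lambda>X. X - A) collapse U G"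
proof -
  have "fibre_sum (\<lambda>X. X - A) ((Pow V - U) \<union> U) (\<lambda>X. bool_sign (collapse X \<in> G))
      = fibre_sum (\<lambda>X. X - A) (Pow V - U) (\<lambda>X. bool_sign (collapse X \<in> G))
        + fibre_bias (\<lambda>X. X - A) collapse U G"
    unfolding fibre_bias_def
  proof (rule fibre_sum_Un)
    show "(\<lambda>X. X - A) ` (Pow V - U) \<inter> (\<lambda>X. X - A) ` U = {}"
      using U_invariant by fastforce
  qed (use finite_U finite_V in auto)
  also have "fibre_sum (\<lambda>X. X - A) (Pow V - U) (\<lambda>X. bool_sign (collapse X \<in> G))
      = real (card (Pow V - U))"
  proof (subst fibre_sum_eq_sum_abs)
    have "collapse X \<notin> G" if "X \<in> Pow V - U" for X
      using that collapse_mem_iff assms by blast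
    then show "bool_sign (collapse X \<in> G) = bool_sign (collapse Y \<in> G)"
      if "X \<in> Pow V - U" "Y \<in> Pow V - U" for X Y using that by simp
  qed (use finite_V in auto)
  also have "real (card (Pow V - U)) = 2 ^ card V - real (card U)"
    using finite_V finite_U U_subset card_mono[OF _ U_subset]
    by (simp add: card_Diff_subset card_Pow of_nat_diff)
  finally show ?thesis using U_subset by (simp add: Un_absorb2)
qed

lemma expectation_fibre_bias_collapse_ge:
  "card U / sqrt (3 * 2 ^ (card A - card (ld ` A)))
    \<le> subset_expectation U (fibre_bias (\<lambda>X. X - A) collapse U)"
proof -
  have "collapse ` U \<subseteq> U" using collapse_mem_iff U_subset by blast
  then show ?thesis
    using expectation_fibre_bias_ge[OF finite_U finite_U _ card_collapse_fibre_le] by simp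
qed

lemma fibre_bias_collapse_eq_card:
  assumes "ld ` A = A"
  shows "fibre_bias (\<lambda>X. X - A) collapse U G = card U"
proof -
  have "ld p = p" if "p \<in> A" for p
    using that ld_ld assms by (metis imageE)
  then have "collapse X = X - A" for X by (auto simp: collapse_def)
  then show ?thesis
    unfolding fibre_bias_def by (subst fibre_sum_eq_sum_abs) (auto simp: finite_U)
qed

lemma prob_fibre_bias_collapse_less_le:
  assumes "U \<noteq> {}"
  shows "subset_prob U {G. fibre_bias (\<lambda>X. X - A) collapse U G
      < card U / sqrt (3 * 2 ^ (card A - card (ld ` A))) / 2}
    \<le> 12 * 2 ^ (card A + card (ld ` A)) / card U"
proof -
  define N where "N = (2 :: real) ^ (card A - card (ld ` A))"
  define \<delta> where "\<delta> = card U / sqrt (3 * N) / 2"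
  let ?bias = "fibre_bias (\<lambda>X. X - A) collapse U"
  have "0 < card U" using assms finite_U by (simp add: card_gt_0_iff)
  then have "0 < \<delta>" by (simp add: \<delta>_def N_def)
  have "2 * \<delta> \<le> subset_expectation U ?bias"
    using expectation_fibre_bias_collapse_ge by (simp add: \<delta>_def N_def)
  then have "subset_prob U {G. ?bias G < \<delta>}
      \<le> subset_prob U {G. \<delta> \<le> \<bar>?bias G - subset_expectation U ?bias\<bar>}"
    by (intro measure_pmf.finite_measure_mono) auto
  also have "\<dots> \<le> card U * (real (2 ^ card (ld ` A)))\<^sup>2 / \<delta>\<^sup>2"
    by (intro prob_fibre_bias_deviation_le finite_U \<open>0 < \<delta>\<close> card_collapse_preimage_le U_subset)
  also have "\<dots> = 12 * ((2 ^ card (ld ` A))\<^sup>2 * N) / card U"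
    using \<open>0 < card U\<close> by (simp add: \<delta>_def N_def power_divide power2_eq_square[of "real (card U)"])
  also have "(2 ^ card (ld ` A))\<^sup>2 * N = 2 ^ (card (ld ` A) * 2 + (card A - card (ld ` A)))"
    by (simp only: N_def power_add power_mult)
  also have "card (ld ` A) * 2 + (card A - card (ld ` A)) = card A + card (ld ` A)"
    using card_mono[OF finite_A leaders_subset] by simp
  finally show ?thesis by (simp add: \<delta>_def N_def)
qed

end

lemma close_to_junta_collapse:
  assumes "blocks_on {..<n} A ld U" "n - card A \<le> k" "G \<subseteq> U"
    and bias: "real (card U) - 2 * \<epsilon> * 2 ^ n \<le> fibre_bias (\<lambda>X. X - A) (blocks.collapse A ld) U G"
  shows "close_to_junta n k \<epsilon> (\<lambda>x. blocks.collapse A ld (ones x) \<in> G)"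
proof -
  interpret blocks_on "{..<n}" A ld U by (rule assms(1))
  show ?thesis
  proof (rule close_to_junta_if_fibre_sum_ge)
    show "card ({..<n} - A) \<le> k"
      using assms(2) A_subset finite_A by (simp add: card_Diff_subset)
    have "(1 - 2 * \<epsilon>) * 2 ^ n \<le> fibre_sum (\<lambda>X. X - A) (Pow {..<n}) (\<lambda>X. bool_sign (collapse X \<in> G))"
      using bias unfolding fibre_sum_collapse[OF assms(3)] by (simp add: algebra_simps)
    also have "\<dots> = fibre_sum (\<lambda>X. X \<inter> ({..<n} - A)) (Pow {..<n}) (\<lambda>X. bool_sign (collapse X \<in> G))"
      by (rule fibre_sum_cong) auto
    finally show "(1 - 2 * \<epsilon>) * 2 ^ n
        \<le> fibre_sum (\<lambda>x. ones x \<inter> ({..<n} - A)) (cube n) (\<lambda>x. bool_sign (collapse (ones x) \<in> G))"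
      by (subst fibre_sum_cube)
  qed simp
qed

lemma prob_collapse_not_close_le:
  assumes "blocks_on {..<n} A ld U" "n - card A \<le> k" "U \<noteq> {}"
    and gap: "real (card U) - 2 * \<epsilon> * 2 ^ n \<le> card U / sqrt (3 * 2 ^ (card A - card (ld ` A))) / 2"
  shows "subset_prob U {G. \<not> close_to_junta n k \<epsilon> (\<lambda>x. blocks.collapse A ld (ones x) \<in> G)}
    \<le> 12 * 2 ^ (card A + card (ld ` A)) / card U"
proof -
  interpret blocks_on "{..<n}" A ld U by (rule assms(1))
  have "fibre_bias (\<lambda>X. X - A) collapse U G < card U / sqrt (3 * 2 ^ (card A - card (ld ` A))) / 2"
    if "G \<subseteq> U" "\<not> close_to_junta n k \<epsilon> (\<lambda>x. collapse (ones x) \<in> G)" for G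
    using close_to_junta_collapse[OF assms(1,2) that(1), of \<epsilon>] that(2) gap by linarith
  then have "subset_prob U {G. \<not> close_to_junta n k \<epsilon> (\<lambda>x. collapse (ones x) \<in> G)}
      \<le> subset_prob U {G. fibre_bias (\<lambda>X. X - A) collapse U G
          < card U / sqrt (3 * 2 ^ (card A - card (ld ` A))) / 2}"
    by (intro subset_prob_mono finite_U) simp
  also have "\<dots> \<le> 12 * 2 ^ (card A + card (ld ` A)) / card U"
    by (rule prob_fibre_bias_collapse_less_le[OF assms(3)])
  finally show ?thesis .
qed

section \<open>Hiding the blocks\<close>

lemma card_PiE_agree_le:
  assumes "finite I" "\<And>i. i \<in> I \<Longrightarrow> finite (B i)" "\<Phi> \<subseteq> Pi\<^sub>E I B"
    and "\<And>\<phi> i. \<phi> \<in> \<Phi> \<Longrightarrow> i \<in> J \<Longrightarrow> \<phi> i = \<psi> i"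
  shows "card \<Phi> \<le> card (Pi\<^sub>E (I - J) B)"
proof (rule card_inj_on_le)
  show "inj_on (\<lambda>\<phi>. restrict \<phi> (I - J)) \<Phi>"
  proof (rule inj_onI)
    fix \<phi> \<phi>' assume same_restriction: "\<phi> \<in> \<Phi>" "\<phi>' \<in> \<Phi>" "restrict \<phi> (I - J) = restrict \<phi>' (I - J)"
    show "\<phi> = \<phi>'"
    proof (rule PiE_ext[where k = I and s = B])
      show "\<phi> \<in> Pi\<^sub>E I B" "\<phi>' \<in> Pi\<^sub>E I B" using same_restriction assms(3) by auto
      show "\<phi> i = \<phi>' i" if "i \<in> I" for i
      proof (cases "i \<in> J")
        case True
        then show ?thesis
          using assms(4)[OF same_restriction(1)] assms(4)[OF same_restriction(2)] by simp
      next
        case False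
        then show ?thesis using fun_cong[OF same_restriction(3), of i] that by simp
      qed
    qed
  qed
  show "(\<lambda>\<phi>. restrict \<phi> (I - J)) ` \<Phi> \<subseteq> Pi\<^sub>E (I - J) B"
  proof (rule image_subsetI)
    fix \<phi> assume "\<phi> \<in> \<Phi>"
    then have "\<phi> \<in> Pi\<^sub>E I B" using assms(3) by blast
    then show "restrict \<phi> (I - J) \<in> Pi\<^sub>E (I - J) B" by (simp add: restrict_PiE_iff PiE_mem)
  qed
  show "finite (Pi\<^sub>E (I - J) B)"
    using assms(1,2) by (intro finite_PiE) auto
qed

text \<open>
  One element is hidden in each of the bins \<open>B i\<close>.  The hidden elements of the bins with the same
  \<open>lead i\<close> form a block, whose leader is the element hidden in the bin \<open>lead i\<close>.
\<close>
locale hidden_blocks =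
  fixes V :: "'a set" and I :: "'i set" and B :: "'i \<Rightarrow> 'a set" and lead :: "'i \<Rightarrow> 'i" and b t :: nat
  assumes finite_V: "finite V" and finite_I: "finite I" and disjoint: "disjoint_family_on B I"
    and B_subset: "i \<in> I \<Longrightarrow> B i \<subseteq> V" and card_B: "i \<in> I \<Longrightarrow> card (B i) = b" and b_pos: "0 < b"
    and lead_in: "i \<in> I \<Longrightarrow> lead i \<in> I" and lead_lead: "i \<in> I \<Longrightarrow> lead (lead i) = lead i"
    and card_block: "i \<in> I \<Longrightarrow> t \<le> card {i' \<in> I. lead i' = lead i}"
begin

definition hidings :: "('i \<Rightarrow> 'a) set" where
  "hidings = Pi\<^sub>E I B"

definition leader :: "('i \<Rightarrow> 'a) \<Rightarrow> 'a \<Rightarrow> 'a" where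
  "leader \<phi> p = \<phi> (lead (the_inv_into I \<phi> p))"

definition hidden_collapse :: "('i \<Rightarrow> 'a) \<Rightarrow> 'a set \<Rightarrow> 'a set" where
  "hidden_collapse \<phi> = blocks.collapse (\<phi> ` I) (leader \<phi>)"

lemma finite_B: "i \<in> I \<Longrightarrow> finite (B i)"
  using finite_subset[OF B_subset finite_V] .

lemma finite_hidings: "finite hidings"
  by (simp add: hidings_def finite_PiE finite_I finite_B)

lemma card_hidings: "card hidings = b ^ card I"
  by (simp add: hidings_def card_PiE finite_I card_B)

lemma hidings_nonempty: "hidings \<noteq> {}"
  using card_hidings b_pos by force

lemma hidings_mem: "\<phi> \<in> hidings \<Longrightarrow> i \<in> I \<Longrightarrow> \<phi> i \<in> B i"
  by (auto simp: hidings_def)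

lemma hidings_eq_imp_eq:
  assumes "\<phi> \<in> hidings" "\<psi> \<in> hidings" "i \<in> I" "i' \<in> I" "\<phi> i = \<psi> i'"
  shows "i = i'"
  using assms disjoint hidings_mem[OF assms(1,3)] hidings_mem[OF assms(2,4)]
  by (auto simp: disjoint_family_on_def)

lemma inj_on_hidings: "\<phi> \<in> hidings \<Longrightarrow> inj_on \<phi> I"
  by (auto intro: inj_onI hidings_eq_imp_eq)

lemma leader_apply: "\<phi> \<in> hidings \<Longrightarrow> i \<in> I \<Longrightarrow> leader \<phi> (\<phi> i) = \<phi> (lead i)"
  by (simp add: leader_def the_inv_into_f_f inj_on_hidings)

lemma card_hidden: "\<phi> \<in> hidings \<Longrightarrow> card (\<phi> ` I) = card I"
  by (simp add: card_image inj_on_hidings)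

lemma leader_image: "\<phi> \<in> hidings \<Longrightarrow> leader \<phi> ` \<phi> ` I = \<phi> ` lead ` I"
  by (simp add: image_image leader_apply cong: image_cong)

lemma card_leaders:
  assumes "\<phi> \<in> hidings"
  shows "card (leader \<phi> ` \<phi> ` I) = card (lead ` I)"
proof -
  have "inj_on \<phi> (lead ` I)"
    using inj_on_hidings[OF assms] lead_in by (auto intro: inj_on_subset)
  then show ?thesis by (simp add: leader_image[OF assms] card_image)
qed

lemma blocks_hidden:
  assumes "\<phi> \<in> hidings"
  shows "blocks V (\<phi> ` I) (leader \<phi>)"
proof
  show "\<phi> ` I \<subseteq> V" using hidings_mem[OF assms] B_subset by auto
qed (use finite_V leader_apply[OF assms] lead_in lead_lead in auto)

lemma hidden_collapse_collision:
  assumes "\<phi> \<in> hidings" "hidden_collapse \<phi> X = hidden_collapse \<phi> Y" "X \<noteq> Y"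
  shows "sym_diff X Y \<subseteq> \<phi> ` I" and "t \<le> card {i \<in> I. \<phi> i \<in> sym_diff X Y}"
proof -
  interpret blocks V "\<phi> ` I" "leader \<phi>" by (rule blocks_hidden[OF assms(1)])
  have same_collapse: "collapse X = collapse Y" using assms(2) by (simp add: hidden_collapse_def)
  then show "sym_diff X Y \<subseteq> \<phi> ` I" unfolding collapse_eq_iff by blast
  obtain i where "i \<in> I" and block: "{r \<in> \<phi> ` I. leader \<phi> r = leader \<phi> (\<phi> i)} \<subseteq> sym_diff X Y"
    using collapse_eq_imp_ex_block[OF same_collapse assms(3)] by auto
  then have "{i' \<in> I. lead i' = lead i} \<subseteq> {i \<in> I. \<phi> i \<in> sym_diff X Y}"
    using leader_apply[OF assms(1)] by auto
  then have "card {i' \<in> I. lead i' = lead i} \<le> card {i \<in> I. \<phi> i \<in> sym_diff X Y}"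
    using finite_I by (intro card_mono) auto
  with card_block[OF \<open>i \<in> I\<close>] show "t \<le> card {i \<in> I. \<phi> i \<in> sym_diff X Y}" by linarith
qed

text \<open>
  If \<open>X\<close> and \<open>Y\<close> collide, then their difference contains a block and no other than hidden
  elements, so it reveals the hidden element of at least \<open>t\<close> bins.
\<close>
lemma prob_hidden_collapse_collision_le:
  assumes "X \<noteq> Y"
  shows "measure_pmf.prob (pmf_of_set hidings) {\<phi>. hidden_collapse \<phi> X = hidden_collapse \<phi> Y}
      \<le> 1 / real b ^ t"
proof (cases "\<exists>\<psi> \<in> hidings. hidden_collapse \<psi> X = hidden_collapse \<psi> Y")
  case False
  then have "hidings \<inter> {\<phi>. hidden_collapse \<phi> X = hidden_collapse \<phi> Y} = {}" by blast
  then show ?thesis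
    by (simp add: measure_pmf_of_set finite_hidings hidings_nonempty)
next
  case True
  then obtain \<psi> where \<psi>_collides: "\<psi> \<in> hidings" "hidden_collapse \<psi> X = hidden_collapse \<psi> Y" by blast
  define J where "J = {i \<in> I. \<psi> i \<in> sym_diff X Y}"
  have agree: "\<phi> i = \<psi> i"
    if \<phi>: "\<phi> \<in> hidings \<inter> {\<phi>. hidden_collapse \<phi> X = hidden_collapse \<phi> Y}" and i: "i \<in> J" for \<phi> i
  proof -
    have "\<psi> i \<in> \<phi> ` I" using hidden_collapse_collision(1)[of \<phi> X Y] \<phi> assms i by (auto simp: J_def)
    then obtain i' where i': "i' \<in> I" "\<psi> i = \<phi> i'" by auto
    then have "i = i'" using hidings_eq_imp_eq[OF \<psi>_collides(1), of \<phi> i i'] \<phi> i by (simp add: J_def)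
    then show ?thesis using i'(2) by simp
  qed
  have J_bounds: "J \<subseteq> I" "t \<le> card J"
    using hidden_collapse_collision(2)[OF \<psi>_collides assms] by (auto simp: J_def)
  then have "card J \<le> card I" using finite_I by (intro card_mono)
  have "card (hidings \<inter> {\<phi>. hidden_collapse \<phi> X = hidden_collapse \<phi> Y}) \<le> card (Pi\<^sub>E (I - J) B)"
    using agree finite_I finite_B by (intro card_PiE_agree_le[where \<psi> = \<psi>]) (auto simp: hidings_def)
  also have "\<dots> = b ^ (card I - card J)"
    using finite_I J_bounds(1) by (simp add: card_PiE card_B card_Diff_subset finite_subset)
  also have "\<dots> \<le> b ^ (card I - t)"
    using J_bounds(2) b_pos by (intro power_increasing) auto
  finally have "real (card (hidings \<inter> {\<phi>. hidden_collapse \<phi> X = hidden_collapse \<phi> Y}))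
      \<le> real b ^ (card I - t)"
    by (metis of_nat_le_iff of_nat_power)
  also have "\<dots> = real b ^ card I / real b ^ t"
    using b_pos J_bounds(2) \<open>card J \<le> card I\<close> by (intro power_diff) auto
  finally show ?thesis
    using b_pos
    by (simp add: measure_pmf_of_set finite_hidings hidings_nonempty card_hidings field_simps)
qed

lemma blocks_on_hidden:
  assumes "\<phi> \<in> hidings" "\<And>i. i \<in> I \<Longrightarrow> B i \<inter> S = {}"
  shows "blocks_on V (\<phi> ` I) (leader \<phi>) {X \<in> Pow V. X \<inter> S \<in> R}"
proof -
  interpret blocks V "\<phi> ` I" "leader \<phi>" by (rule blocks_hidden[OF assms(1)])
  have "\<phi> ` I \<inter> S = {}" using hidings_mem[OF assms(1)] assms(2) by fastforce
  then have visible: "X \<inter> S = Y \<inter> S" if "X - \<phi> ` I = Y - \<phi> ` I" for X Y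
    using that by blast
  show ?thesis
  proof
    show "Y \<in> {X \<in> Pow V. X \<inter> S \<in> R}"
      if "X \<in> {X \<in> Pow V. X \<inter> S \<in> R}" "Y \<subseteq> V" "X - \<phi> ` I = Y - \<phi> ` I" for X Y
      using that visible[OF that(3)] by simp
  qed auto
qed

end

lemma hidden_blocks_query_bound:
  assumes hidden: "hidden_blocks {..<n} I B lead b t"
    and tester: "tolerant_junta_tester n k \<epsilon>1 \<epsilon>2 T" "makes_at_most q T"
    and invariant: "\<And>\<phi>. \<phi> \<in> hidden_blocks.hidings I B \<Longrightarrow>
      blocks_on {..<n} (\<phi> ` I) (hidden_blocks.leader I lead \<phi>) U"
    and far: "9 / 10 \<le> subset_prob U {G. far_from_juntas n k \<epsilon>2 (\<lambda>x. ones x \<in> G)}"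
    and close: "\<And>\<phi>. \<phi> \<in> hidden_blocks.hidings I B \<Longrightarrow> 9 / 10 \<le> subset_prob U
      {G. close_to_junta n k \<epsilon>1 (\<lambda>x. hidden_blocks.hidden_collapse I lead \<phi> (ones x) \<in> G)}"
  shows "real b ^ t \<le> 3 * (real q)\<^sup>2"
proof -
  interpret hidden_blocks "{..<n}" I B lead b t by (rule hidden)
  have support: "set_pmf (pmf_of_set hidings) = hidings"
    by (simp add: set_pmf_of_set finite_hidings hidings_nonempty)
  obtain \<phi>0 where "\<phi>0 \<in> hidings" using hidings_nonempty by blast
  have "1 \<le> 3 * real (q * (q - 1)) * (1 / real b ^ t)"
  proof (rule tolerant_junta_tester_collision_bound[OF tester,
        where ?K0.0 = ones and K = "\<lambda>\<phi> x. hidden_collapse \<phi> (ones x)"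
        and U = U and \<Phi> = "pmf_of_set hidings"])
    show "finite U" by (rule blocks_on.finite_U[OF invariant[OF \<open>\<phi>0 \<in> hidings\<close>]])
    show "hidden_collapse \<phi> (ones x) \<in> U \<longleftrightarrow> ones x \<in> U"
      if "\<phi> \<in> set_pmf (pmf_of_set hidings)" "x \<in> cube n" for \<phi> x
      unfolding hidden_collapse_def using that ones_subset
      by (intro blocks_on.collapse_mem_iff[OF invariant]) (auto simp: support)
    show "measure_pmf.prob (pmf_of_set hidings)
        {\<phi>. hidden_collapse \<phi> (ones x) = hidden_collapse \<phi> (ones y)} \<le> 1 / real b ^ t"
      if "x \<in> cube n" "y \<in> cube n" "x \<noteq> y" for x y
      using that inj_on_ones by (intro prob_hidden_collapse_collision_le) (auto simp: inj_on_def)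
  qed (use far close in \<open>auto simp: inj_on_ones random_function_def vimage_def support\<close>)
  then have "real b ^ t \<le> 3 * real (q * (q - 1))"
    using b_pos by (simp add: field_simps)
  also have "\<dots> \<le> 3 * real (q * q)"
    by (intro mult_left_mono of_nat_mono mult_le_mono) auto
  finally show ?thesis by (simp add: power2_eq_square)
qed

lemma exists_disjoint_family_of_card:
  assumes "finite I" "finite W" "card I * b \<le> card W"
  shows "\<exists>B. disjoint_family_on B I \<and> (\<forall>i \<in> I. B i \<subseteq> W \<and> card (B i) = b)"
  using assms
proof (induction I arbitrary: W rule: finite_induct)
  case empty
  then show ?case by (simp add: disjoint_family_on_def)
next
  case (insert i I)
  then have "b \<le> card W" by simp
  then obtain S where S: "S \<subseteq> W" "card S = b" by (rule obtain_subset_with_card_n)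
  have "card I * b \<le> card (W - S)"
    using insert S by (simp add: card_Diff_subset finite_subset)
  then obtain B where B: "disjoint_family_on B I" "\<And>i. i \<in> I \<Longrightarrow> B i \<subseteq> W - S \<and> card (B i) = b"
    using insert.IH[of "W - S"] insert.prems by auto
  have "S \<inter> B i' = {}" "B i' \<inter> S = {}" if "i' \<in> I" for i'
    using B(2)[OF that] by auto
  then have "disjoint_family_on (B(i := S)) (insert i I)"
    using B(1) insert.hyps by (simp add: disjoint_family_on_def)
  moreover have "\<forall>i' \<in> insert i I. (B(i := S)) i' \<subseteq> W \<and> card ((B(i := S)) i') = b"
    using B(2) S by auto
  ultimately show ?case by blast
qed

lemma exists_hidden_blocks:
  assumes "finite V" "W \<subseteq> V" "j * t * b \<le> card W" "0 < b"
  shows "\<exists>B. hidden_blocks V ({..<j} \<times> {..<t}) B (\<lambda>(r, u). (r, 0)) b t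
    \<and> (\<forall>i \<in> {..<j} \<times> {..<t}. B i \<subseteq> W)"
proof -
  have "finite W" using assms(1,2) finite_subset by blast
  then obtain B where B: "disjoint_family_on B ({..<j} \<times> {..<t})"
    "\<And>i. i \<in> {..<j} \<times> {..<t} \<Longrightarrow> B i \<subseteq> W \<and> card (B i) = b"
    using exists_disjoint_family_of_card[of "{..<j} \<times> {..<t}" W b] assms(3) by auto
  have "hidden_blocks V ({..<j} \<times> {..<t}) B (\<lambda>(r, u). (r, 0)) b t"
  proof
    show "t \<le> card {i' \<in> {..<j} \<times> {..<t}. (\<lambda>(r, u). (r, 0)) i' = (\<lambda>(r, u). (r, 0 :: nat)) i}"
      if "i \<in> {..<j} \<times> {..<t}" for i
    proof -
      have "{i' \<in> {..<j} \<times> {..<t}. (\<lambda>(r, u). (r, 0)) i' = (\<lambda>(r, u). (r, 0 :: nat)) i}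
          = {fst i} \<times> {..<t}"
        using that by auto
      then show ?thesis by (simp add: card_cartesian_product)
    qed
    show "B i \<subseteq> V" "card (B i) = b" if "i \<in> {..<j} \<times> {..<t}" for i
      using B(2)[OF that] assms(2) by auto
  qed (use assms(1,4) B(1) in auto)
  then show ?thesis using B(2) by blast
qed

lemma card_subsets_Int_mem:
  assumes "finite V" "S \<subseteq> V" "R \<subseteq> Pow S"
  shows "card {X \<in> Pow V. X \<inter> S \<in> R} = card R * 2 ^ (card V - card S)"
proof -
  have "finite S" using assms(1,2) finite_subset by blast
  have "bij_betw (\<lambda>(D, E). D \<union> E) (R \<times> Pow (V - S)) {X \<in> Pow V. X \<inter> S \<in> R}"
  proof (rule bij_betw_byWitness[where f' = "\<lambda>X. (X \<inter> S, X - S)"])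
    have "(D \<union> E) \<inter> S = D" "(D \<union> E) - S = E" "D \<union> E \<subseteq> V" if "D \<in> R" "E \<subseteq> V - S" for D E
      using that assms(2,3) by auto
    then show "\<forall>p \<in> R \<times> Pow (V - S).
        ((case p of (D, E) \<Rightarrow> D \<union> E) \<inter> S, (case p of (D, E) \<Rightarrow> D \<union> E) - S) = p"
      and "(\<lambda>(D, E). D \<union> E) ` (R \<times> Pow (V - S)) \<subseteq> {X \<in> Pow V. X \<inter> S \<in> R}"
      by simp_all force
  qed auto
  then have "card (R \<times> Pow (V - S)) = card {X \<in> Pow V. X \<inter> S \<in> R}"
    by (rule bij_betw_same_card)
  then show ?thesis
    using assms \<open>finite S\<close> by (simp add: card_cartesian_product card_Pow card_Diff_subset)
qed

section \<open>Choice of parameters\<close>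

definition bin_size :: "nat \<Rightarrow> nat \<Rightarrow> nat" where
  "bin_size k t = (k + 11 * t) div (22 * t)"

lemma choose_le_power_div_ten:
  assumes "10 * a \<le> k" "8 \<le> k"
  shows "real ((k + a) choose k) / 2 ^ k \<le> 1 / 10"
proof -
  have "real ((k + a) choose a) * (1 / 8) ^ a
      \<le> (\<Sum>i\<le>k + a. real ((k + a) choose i) * (1 / 8) ^ i * 1 ^ (k + a - i))"
    using member_le_sum[of a "{..k + a}"
        "\<lambda>i. real ((k + a) choose i) * (1 / 8) ^ i * 1 ^ (k + a - i)"]
    by simp
  also have "\<dots> = (1 / 8 + 1) ^ (k + a)" by (rule binomial_ring[symmetric])
  finally have "real ((k + a) choose a) \<le> (9 / 8) ^ (k + a) * 8 ^ a" by (simp add: field_simps)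
  also have "\<dots> = (9 / 8) ^ k * 9 ^ a" by (simp add: power_add power_divide)
  finally have "real ((k + a) choose a) ^ 10 \<le> ((9 / 8) ^ k * 9 ^ a) ^ 10"
    by (intro power_mono) auto
  also have "\<dots> = ((9 / 8) ^ 10) ^ k * 9 ^ (10 * a)"
    by (simp only: power_mult_distrib power_mult[symmetric] mult.commute)
  also have "\<dots> \<le> ((9 / 8) ^ 10) ^ k * 9 ^ k"
    using assms(1) by (intro mult_left_mono power_increasing) auto
  also have "\<dots> = ((9 / 8) ^ 10 * 9) ^ k" by (simp add: power_mult_distrib)
  also have "\<dots> \<le> 32 ^ k" by (intro power_mono) (auto simp: power_divide)
  finally have "(real ((k + a) choose a) / 2 ^ k) ^ 10 \<le> 32 ^ k / (2 ^ k) ^ 10"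
    by (simp add: power_divide divide_right_mono)
  also have "((2 :: real) ^ k) ^ 10 = 1024 ^ k"
    by (simp only: power_mult[symmetric] mult.commute[of k]) (simp add: power_mult)
  also have "(32 :: real) ^ k / 1024 ^ k = (1 / 32) ^ k" by (simp flip: power_divide)
  also have "\<dots> \<le> (1 / 32) ^ 8" using assms(2) by (intro power_decreasing) auto
  also have "\<dots> \<le> (1 / 10) ^ 10" by (simp add: power_divide)
  finally have "real ((k + a) choose a) / 2 ^ k \<le> 1 / 10"
    by (rule power_le_imp_le_base[of _ 9, simplified]) simp
  then show ?thesis
    using binomial_symmetric[of k "k + a"] by simp
qed

lemma prob_far_from_juntas_ge:
  assumes "0 < t" "220 * t \<le> k" "m = k + 22 * t" "U \<subseteq> Pow {..<m}"
    and "2 ^ m * (2 * \<epsilon> + 2 * (1 / 2) ^ (11 * t)) \<le> real (card U)"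
  shows "9 / 10 \<le> subset_prob U {G. far_from_juntas m k \<epsilon> (\<lambda>x. ones x \<in> G)}"
proof -
  have "sqrt (2 ^ k * 2 ^ m) = 2 ^ m * (1 / 2) ^ (11 * t)"
  proof (rule real_sqrt_unique)
    have "((1 :: real) / 2) ^ (11 * t) * (1 / 2) ^ (11 * t) = (1 / 2) ^ (22 * t)"
      by (simp flip: power_add)
    then have "(2 ^ m * (1 / 2) ^ (11 * t))\<^sup>2 = 2 ^ m * (2 ^ m * (1 / 2 :: real) ^ (22 * t))"
      by (simp add: power2_eq_square mult_ac)
    also have "2 ^ m * (1 / 2 :: real) ^ (22 * t) = 2 ^ k"
      by (simp add: assms(3) power_add power_divide)
    finally show "(2 ^ m * (1 / 2) ^ (11 * t))\<^sup>2 = 2 ^ k * (2 ^ m :: real)" by simp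
  qed simp
  then have "2 * sqrt (2 ^ k * 2 ^ m) \<le> real (card U) - 2 * \<epsilon> * 2 ^ m"
    using assms(5) by (simp add: algebra_simps)
  then have "subset_prob U {G. \<not> far_from_juntas m k \<epsilon> (\<lambda>x. ones x \<in> G)}
      \<le> real (m choose k) / 2 ^ k"
    by (intro prob_not_far_from_juntas_le assms(4)) (simp add: assms(3))
  also have "\<dots> \<le> 1 / 10"
    unfolding assms(3) using assms(1,2) by (intro choose_le_power_div_ten) auto
  finally show ?thesis
    using measure_pmf.prob_neg[of "random_subset U" "\<lambda>G. far_from_juntas m k \<epsilon> (\<lambda>x. ones x \<in> G)"]
    by simp
qed

lemma half_power_eleven_le:
  assumes "0 < t"
  shows "(1 / 2 :: real) ^ (11 * t) \<le> 1 / 2048"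
proof -
  have "(1 / 2 :: real) ^ (11 * t) \<le> (1 / 2) ^ 11"
    using assms by (intro power_decreasing) auto
  then show ?thesis by (simp add: power_divide)
qed

lemma prob_far_from_juntas_full_ge:
  assumes "0 < t" "220 * t \<le> k" "m = k + 22 * t" "\<epsilon> \<le> 49 / 100"
  shows "9 / 10 \<le> subset_prob (Pow {..<m}) {G. far_from_juntas m k \<epsilon> (\<lambda>x. ones x \<in> G)}"
proof (rule prob_far_from_juntas_ge[OF assms(1-3)])
  have "(2 :: real) ^ m * (2 * \<epsilon> + 2 * (1 / 2) ^ (11 * t)) \<le> 2 ^ m * 1"
    using assms(4) half_power_eleven_le[OF assms(1)] by (intro mult_left_mono) simp_all
  then show "2 ^ m * (2 * \<epsilon> + 2 * (1 / 2) ^ (11 * t)) \<le> real (card (Pow {..<m}))"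
    by (simp add: card_Pow)
qed simp

text \<open>
  A tester must distinguish random functions from constant ones.  This is the case \<open>\<beta> = 1\<close> of the
  collision bound.
\<close>
lemma at_least_two_queries:
  assumes tester: "tolerant_junta_tester n k \<epsilon>1 \<epsilon>2 T" "makes_at_most q T"
    and "k + 242 \<le> n" "0 \<le> \<epsilon>1" "\<epsilon>2 \<le> 49 / 100"
  shows "2 \<le> q"
proof -
  define m where "m = k + 220 + 22 * 1"
  let ?T = "map_pmf (map_queries (take m)) T"
  have "1 \<le> 3 * real (q * (q - 1)) * 1"
  proof (rule tolerant_junta_tester_collision_bound[where T = ?T and n = m and k = k
        and ?\<epsilon>1.0 = \<epsilon>1 and ?\<epsilon>2.0 = \<epsilon>2
        and ?K0.0 = ones and K = "\<lambda>_ _. {}" and U = "Pow {..<m}" and \<Phi> = "return_pmf ()"])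
    show "tolerant_junta_tester m k \<epsilon>1 \<epsilon>2 ?T"
      by (rule tolerant_junta_tester_take[OF _ tester(1)]) (use assms(3) in \<open>simp add: m_def\<close>)
    have "subset_prob (Pow {..<m}) {G. far_from_juntas m (k + 220) \<epsilon>2 (\<lambda>x. ones x \<in> G)}
        \<le> subset_prob (Pow {..<m}) {G. far_from_juntas m k \<epsilon>2 (\<lambda>x. ones x \<in> G)}"
      by (intro measure_pmf.finite_measure_mono) (auto intro: far_from_juntas_mono)
    then show "9 / 10 \<le> measure_pmf.prob (random_function ones (Pow {..<m}))
        {f. far_from_juntas m k \<epsilon>2 f}"
      using prob_far_from_juntas_full_ge[OF _ _ m_def assms(5)]
      by (simp add: random_function_def vimage_def)
    have "close_to_junta m k \<epsilon>1 (\<lambda>_. b)" for b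
      using assms(4) by (intro close_to_junta_self) (simp_all add: junta_iff relevant_vars_const)
    then show "9 / 10 \<le> measure_pmf.prob (random_function (\<lambda>_. {}) (Pow {..<m}))
        {f. close_to_junta m k \<epsilon>1 f}"
      by (simp add: random_function_def vimage_def)
  qed (use makes_at_most_map_queries[OF tester(2)] ones_subset inj_on_ones in auto)
  then show ?thesis by (cases "q \<le> 1") (auto simp: le_Suc_eq)
qed

text \<open>
  The functions live on \<open>k + 22 * t\<close> variables and may be nonzero only if the first \<open>11 * t\<close>
  variables lie in \<open>R\<close>.  The remaining ones are divided into \<open>22 * t\<close> bins, which hide 22 blocks
  of size \<open>t\<close>.
\<close>
lemma bin_size_power_le:
  fixes k t m :: nat and R :: "nat set set"
  defines "m \<equiv> k + 22 * t" and "U \<equiv> {X \<in> Pow {..<k + 22 * t}. X \<inter> {..<11 * t} \<in> R}"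
  assumes tester: "tolerant_junta_tester n k \<epsilon>1 \<epsilon>2 T" "makes_at_most q T"
    and "0 < t" "220 * t \<le> k" "m \<le> n"
    and far: "9 / 10 \<le> subset_prob U {G. far_from_juntas m k \<epsilon>2 (\<lambda>x. ones x \<in> G)}"
    and close: "\<And>A ld. blocks_on {..<m} A ld U \<Longrightarrow> card A = 22 * t \<Longrightarrow> card (ld ` A) = 22 \<Longrightarrow>
      9 / 10 \<le> subset_prob U {G. close_to_junta m k \<epsilon>1 (\<lambda>x. blocks.collapse A ld (ones x) \<in> G)}"
  shows "real (bin_size k t) ^ t \<le> 3 * (real q)\<^sup>2"
proof -
  define I where "I = {..<22 :: nat} \<times> {..<t}"
  have "22 * t * bin_size k t \<le> card {11 * t..<m}"
    using times_div_less_eq_dividend[of "22 * t" "k + 11 * t"]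
    by (simp add: bin_size_def m_def add.commute)
  moreover have "0 < bin_size k t"
    using \<open>0 < t\<close> \<open>220 * t \<le> k\<close> by (simp add: bin_size_def div_greater_zero_iff)
  moreover have "{11 * t..<m} \<subseteq> {..<m}" by auto
  ultimately obtain B where hidden: "hidden_blocks {..<m} I B (\<lambda>(r, u). (r, 0)) (bin_size k t) t"
    and B_subset_tail: "\<And>i. i \<in> I \<Longrightarrow> B i \<subseteq> {11 * t..<m}"
    using exists_hidden_blocks[of "{..<m}" "{11 * t..<m}" 22 t "bin_size k t"] unfolding I_def
    by auto
  interpret hidden_blocks "{..<m}" I B "\<lambda>(r, u). (r, 0)" "bin_size k t" t by (rule hidden)
  have blocks: "blocks_on {..<m} (\<phi> ` I) (leader \<phi>) U" if "\<phi> \<in> hidings" for \<phi>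
    unfolding U_def m_def[symmetric] using B_subset_tail
    by (intro blocks_on_hidden[OF that]) fastforce
  have "card I = 22 * t" by (simp add: I_def card_cartesian_product)
  moreover have "(\<lambda>(r, u). (r, 0 :: nat)) ` I = {..<22} \<times> {0}" using \<open>0 < t\<close> by (force simp: I_def)
  then have "card ((\<lambda>(r, u). (r, 0 :: nat)) ` I) = 22" by (simp add: card_cartesian_product)
  ultimately show ?thesis
    using blocks far close card_hidden card_leaders \<open>m \<le> n\<close>
    by (intro hidden_blocks_query_bound[OF hidden tolerant_junta_tester_take[OF _ tester(1)]
          makes_at_most_map_queries[OF tester(2)]]) (auto simp: hidden_collapse_def)
qed

text \<open>
  With blocks of size one, the leaders are all of the hidden variables, and collapsing makes every
  function a junta.
\<close>
lemma bin_size_le_large_gap: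
  assumes tester: "tolerant_junta_tester n k \<epsilon>1 \<epsilon>2 T" "makes_at_most q T"
    and "220 \<le> k" "k + 22 \<le> n" "0 \<le> \<epsilon>1" "\<epsilon>2 \<le> 49 / 100"
  shows "real (bin_size k 1) \<le> 3 * (real q)\<^sup>2"
proof -
  define m where "m = k + 22 * 1"
  have U_eq: "{X \<in> Pow {..<k + 22 * 1}. X \<inter> {..<11 * 1 :: nat} \<in> Pow {..<11 * 1}} = Pow {..<m}"
    by (auto simp: m_def)
  have "close_to_junta m k \<epsilon>1 (\<lambda>x. blocks.collapse A ld (ones x) \<in> G)"
    if blocks: "blocks_on {..<m} A ld (Pow {..<m})" and card: "card A = 22" "card (ld ` A) = 22"
      and "G \<subseteq> Pow {..<m}" for A ld G
  proof -
    interpret blocks_on "{..<m}" A ld "Pow {..<m}" by (rule blocks)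
    have "ld ` A = A" using card_subset_eq[OF finite_A leaders_subset] card by simp
    then have "fibre_bias (\<lambda>X. X - A) collapse (Pow {..<m}) G = card (Pow {..<m})"
      by (rule fibre_bias_collapse_eq_card)
    then show ?thesis
      using assms(5) card
      by (intro close_to_junta_collapse[OF blocks _ \<open>G \<subseteq> Pow {..<m}\<close>]) (simp_all add: m_def)
  qed
  then have close: "subset_prob (Pow {..<m})
      {G. close_to_junta m k \<epsilon>1 (\<lambda>x. blocks.collapse A ld (ones x) \<in> G)} = 1"
    if "blocks_on {..<m} A ld (Pow {..<m})" "card A = 22" "card (ld ` A) = 22" for A ld
    using that by (subst measure_pmf.prob_eq_1) (auto simp: AE_measure_pmf_iff Pow_not_empty)
  have "real (bin_size k 1) ^ 1 \<le> 3 * (real q)\<^sup>2"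
  proof (rule bin_size_power_le[OF tester, where t = 1 and R = "Pow {..<11 * 1}",
        unfolded U_eq, folded m_def])
    show "9 / 10 \<le> subset_prob (Pow {..<m}) {G. far_from_juntas m k \<epsilon>2 (\<lambda>x. ones x \<in> G)}"
      using assms(3,6) by (intro prob_far_from_juntas_full_ge[OF _ _ m_def]) auto
  qed (use assms(3,4) close in \<open>simp_all add: m_def\<close>)
  then show ?thesis by simp
qed

lemma exists_family_of_density:
  fixes x :: real
  assumes "0 \<le> x" "x \<le> 1"
  shows "\<exists>R \<subseteq> Pow {..<s :: nat}. 2 ^ s * x \<le> real (card R) \<and> real (card R) \<le> 2 ^ s * x + 1"
proof -
  define r where "r = nat \<lceil>2 ^ s * x\<rceil>"
  have "0 \<le> 2 ^ s * x" using assms by simp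
  then have r_bounds: "2 ^ s * x \<le> real r" "real r \<le> 2 ^ s * x + 1"
    unfolding r_def by linarith+
  have "2 ^ s * x \<le> of_int (2 ^ s)" using assms(2) by simp
  then have "\<lceil>2 ^ s * x\<rceil> \<le> 2 ^ s" unfolding ceiling_le_iff .
  then have "r \<le> card (Pow {..<s})" by (simp add: r_def card_Pow nat_le_iff)
  then obtain R where "R \<subseteq> Pow {..<s}" "card R = r" by (rule obtain_subset_with_card_n)
  with r_bounds show ?thesis by blast
qed

lemma half_power_le_inverse_sqrt:
  assumes "0 < t"
  shows "1024 * (1 / 2) ^ (11 * t) \<le> 1 / sqrt (3 * 2 ^ (22 * t - 22))"
proof -
  define e :: real where "e = (1 / 2) ^ (11 * t)"
  have "0 < e" by (simp add: e_def)
  have "sqrt (3 * 2 ^ (22 * t - 22)) \<le> 1 / (1024 * e)"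
  proof (rule real_le_lsqrt)
    have "e\<^sup>2 = 1 / 2 ^ (22 * t)" by (simp add: e_def power_divide flip: power_mult)
    then show "3 * 2 ^ (22 * t - 22) \<le> (1 / (1024 * e))\<^sup>2"
      using assms by (simp add: power_divide power_mult_distrib power_diff)
  qed (use \<open>0 < e\<close> in auto)
  then have "1024 * e \<le> 1 / sqrt (3 * 2 ^ (22 * t - 22))"
    using \<open>0 < e\<close> by (simp add: field_simps)
  then show ?thesis by (simp add: e_def)
qed

text \<open>
  With 22 blocks the bias is larger than that of a random function by a factor of about \<open>2 ^ 11\<close>,
  which makes up for the density \<open>1 / 50\<close> of \<open>U\<close>.
\<close>
lemma prob_collapse_close_ge:
  fixes k t :: nat
  defines "m \<equiv> k + 22 * t"
  assumes blocks: "blocks_on {..<m} A ld U" and card: "card A = 22 * t" "card (ld ` A) = 22"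
    and "0 < t" "35 \<le> k"
    and density: "2 ^ m * (1 / 50) \<le> real (card U)"
      "real (card U) \<le> 2 ^ m * (2 * \<epsilon> + 5 * (1 / 2) ^ (11 * t))"
  shows "9 / 10 \<le> subset_prob U {G. close_to_junta m k \<epsilon> (\<lambda>x. blocks.collapse A ld (ones x) \<in> G)}"
proof -
  define e :: real where "e = (1 / 2) ^ (11 * t)"
  define bias where "bias = card U / sqrt (3 * 2 ^ (22 * t - 22))"
  have "0 < e" by (simp add: e_def)
  have "2 ^ m * (1 / 50) * (1024 * e) \<le> real (card U) * (1 / sqrt (3 * 2 ^ (22 * t - 22)))"
    using density(1) half_power_le_inverse_sqrt[OF \<open>0 < t\<close>] \<open>0 < e\<close>
    by (intro mult_mono) (auto simp: e_def)
  then have "512 * (2 ^ m * e) \<le> 25 * bias"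
    by (simp add: bias_def mult_ac)
  moreover have "real (card U) - 2 * \<epsilon> * 2 ^ m \<le> 5 * (2 ^ m * e)"
    using density(2) by (simp add: e_def algebra_simps)
  moreover have "0 < 2 ^ m * e" using \<open>0 < e\<close> by simp
  ultimately have gap: "real (card U) - 2 * \<epsilon> * 2 ^ m
      \<le> card U / sqrt (3 * 2 ^ (card A - card (ld ` A))) / 2"
    unfolding card bias_def[symmetric] by linarith
  have "0 < real (card U)" by (rule less_le_trans[OF _ density(1)]) simp
  then have "U \<noteq> {}" by auto
  have "subset_prob U {G. \<not> close_to_junta m k \<epsilon> (\<lambda>x. blocks.collapse A ld (ones x) \<in> G)}
      \<le> 12 * 2 ^ (22 * t + 22) / card U"
    using prob_collapse_not_close_le[OF blocks _ \<open>U \<noteq> {}\<close> gap] card by (simp add: m_def)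
  also have "\<dots> \<le> 12 * 2 ^ (22 * t + 22) / (2 ^ m * (1 / 50))"
    using density(1) \<open>0 < real (card U)\<close> by (intro divide_left_mono) auto
  also have "\<dots> \<le> 1 / 10"
  proof -
    have "(2 :: real) ^ 35 \<le> 2 ^ k" using \<open>35 \<le> k\<close> by (intro power_increasing) auto
    then show ?thesis by (simp add: m_def power_add field_simps)
  qed
  finally show ?thesis
    using measure_pmf.prob_neg[of "random_subset U"
        "\<lambda>G. close_to_junta m k \<epsilon> (\<lambda>x. blocks.collapse A ld (ones x) \<in> G)"] by simp
qed

text \<open>
  \<open>U\<close> gets a density between \<open>2 * \<epsilon>2 + 2 * e\<close> and \<open>2 * \<epsilon>2 + 3 * e\<close>, where \<open>e = (1 / 2) ^ (11 * t)\<close>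
  is the bias of a random function; the gap between the distances is at most \<open>e\<close>.
\<close>
lemma bin_size_power_le_small_gap:
  assumes tester: "tolerant_junta_tester n k \<epsilon>1 \<epsilon>2 T" "makes_at_most q T"
    and "0 < t" "220 * t \<le> k" "k + 22 * t \<le> n"
    and eps: "1 / 100 \<le> \<epsilon>1" "\<epsilon>1 < \<epsilon>2" "\<epsilon>2 \<le> 49 / 100" "\<epsilon>2 - \<epsilon>1 \<le> (1 / 2) ^ (11 * t)"
  shows "real (bin_size k t) ^ t \<le> 3 * (real q)\<^sup>2"
proof -
  define m where "m = k + 22 * t"
  define e :: real where "e = (1 / 2) ^ (11 * t)"
  have "0 < e" "e \<le> 1 / 2048" and e_inverse: "2 ^ (11 * t) * e = 1"
    using half_power_eleven_le[OF \<open>0 < t\<close>] by (simp_all add: e_def power_divide)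
  then obtain R where R: "R \<subseteq> Pow {..<11 * t}"
    and R_ge: "2 ^ (11 * t) * (2 * \<epsilon>2 + 2 * e) \<le> real (card R)"
    and R_le: "real (card R) \<le> 2 ^ (11 * t) * (2 * \<epsilon>2 + 2 * e) + 1"
    using exists_family_of_density[of "2 * \<epsilon>2 + 2 * e" "11 * t"] eps by auto
  define U where "U = {X \<in> Pow {..<k + 22 * t}. X \<inter> {..<11 * t} \<in> R}"
  have card_U: "real (card U) = real (card R) * 2 ^ (k + 11 * t)"
    unfolding U_def by (subst card_subsets_Int_mem) (use R in auto)
  have power_m: "(2 :: real) ^ m = 2 ^ (11 * t) * 2 ^ (k + 11 * t)"
    by (simp add: m_def flip: power_add)
  have lower: "2 ^ m * (2 * \<epsilon>2 + 2 * e) \<le> real (card U)"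
    using mult_right_mono[OF R_ge, of "2 ^ (k + 11 * t)"] unfolding card_U power_m
    by (simp add: mult_ac)
  have "real (card R) \<le> 2 ^ (11 * t) * (2 * \<epsilon>2 + 3 * e)"
    using R_le e_inverse by (simp add: algebra_simps)
  from mult_right_mono[OF this, of "2 ^ (k + 11 * t)"]
  have "real (card U) \<le> 2 ^ m * (2 * \<epsilon>2 + 3 * e)"
    unfolding card_U power_m by (simp add: mult_ac)
  also have "\<dots> \<le> 2 ^ m * (2 * \<epsilon>1 + 5 * e)"
    using eps(4) by (intro mult_left_mono) (auto simp: e_def)
  finally have upper: "real (card U) \<le> 2 ^ m * (2 * \<epsilon>1 + 5 * e)" .
  have "2 ^ m * (1 / 50) \<le> real (card U)"
    by (rule order_trans[OF mult_left_mono lower]) (use eps \<open>0 < e\<close> in auto)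
  with upper show ?thesis
    using lower assms(3-5) unfolding e_def U_def m_def
    by (intro bin_size_power_le[OF tester] prob_far_from_juntas_ge[OF _ _ refl]
      prob_collapse_close_ge) auto
qed

lemma powr_le_of_power_le:
  fixes k q b t :: nat
  assumes "2 \<le> q" "1 \<le> k" "real k powr (1 / 200) \<le> real b" "real b ^ t \<le> 3 * (real q)\<^sup>2"
    and "y \<le> real t / 800"
  shows "real k powr y \<le> real q"
proof -
  have "real k powr (real t / 200) = (real k powr (1 / 200)) ^ t"
    using assms(2) by (simp add: powr_powr flip: powr_realpow)
  also have "\<dots> \<le> real b ^ t" using assms(3) by (intro power_mono) auto
  also have "\<dots> \<le> 2\<^sup>2 * (real q)\<^sup>2"
    by (rule order_trans[OF assms(4)]) simp
  also have "\<dots> \<le> (real q)\<^sup>2 * (real q)\<^sup>2"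
    using assms(1) by (intro mult_right_mono power_mono) auto
  also have "\<dots> = real q ^ 4" by (simp flip: power_add)
  finally have "(real k powr (real t / 800)) ^ 4 \<le> real q ^ 4"
    using assms(2) by (simp add: powr_powr flip: powr_realpow)
  then have "real k powr (real t / 800) \<le> real q"
    by (rule power_le_imp_le_base[of _ 3, simplified]) simp
  moreover have "real k powr y \<le> real k powr (real t / 800)"
    using assms(2,5) by (intro powr_mono) auto
  ultimately show ?thesis by simp
qed

lemma bin_size_ge:
  fixes k t :: nat
  assumes "1 \<le> t" "1 \<le> k" "real t \<le> D * real k powr 0.99" "220 * D \<le> real k powr (1 / 200)"
  shows "220 * t \<le> k" "real k powr (1 / 200) \<le> real (bin_size k t)"
proof -
  define z where "z = real k powr (1 / 200)"
  have "1 \<le> z" using assms(2) by (simp add: z_def ge_one_powr_ge_zero)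
  have "220 * (real t * z) \<le> 220 * (D * real k powr 0.99 * z)"
    using assms(3) \<open>1 \<le> z\<close> by (intro mult_left_mono mult_right_mono) auto
  also have "\<dots> = 220 * D * (real k powr 0.99 * z)" by simp
  also have "\<dots> \<le> z * (real k powr 0.99 * z)"
    using assms(4) \<open>1 \<le> z\<close> unfolding z_def by (intro mult_right_mono) auto
  also have "\<dots> = real k powr 1" unfolding z_def by (simp flip: powr_add)
  finally have tz_le: "220 * (real t * z) \<le> real k" using assms(2) by simp
  have t_le: "real t * 1 \<le> real t * z" using \<open>1 \<le> z\<close> by (intro mult_left_mono) auto
  with tz_le show "220 * t \<le> k" by (simp flip: of_nat_le_iff)
  have "(z + 1) * real (22 * t) \<le> 22 * (real t * z) + 22 * (real t * z)"
    using t_le by (simp add: algebra_simps)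
  also have "\<dots> \<le> real k" using tz_le t_le of_nat_0_le_iff[of t] by linarith
  also have "\<dots> \<le> real (k + 11 * t)" by simp
  finally have "z \<le> real (k + 11 * t) / real (22 * t) - 1"
    using assms(1) by (simp add: field_simps)
  also have "\<dots> \<le> real (bin_size k t)"
    unfolding bin_size_def
    using floor_divide_of_nat_eq[of "k + 11 * t" "22 * t", where ?'a = real] by linarith
  finally show "real k powr (1 / 200) \<le> real (bin_size k t)" by (simp add: z_def)
qed

lemma exists_block_size:
  fixes l :: real
  assumes "0 \<le> l" "l \<le> D * x" "1 \<le> D" "1 \<le> x"
  shows "\<exists>t :: nat. 1 \<le> t \<and> real t \<le> D * x \<and> l \<le> 22 * real t \<and> (t = 1 \<or> 11 * real t \<le> l)"
proof (cases "22 \<le> l")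
  case True
  define t where "t = nat \<lfloor>l / 11\<rfloor>"
  have "1 \<le> t" "real t \<le> l / 11" "l / 11 < real t + 1"
    using True unfolding t_def by linarith+
  then show ?thesis using assms(2) by (intro exI[of _ t]) auto
next
  case False
  have "1 \<le> D * x" using mult_mono[OF assms(3,4)] assms(3) by simp
  with False show ?thesis by (intro exI[of _ 1]) auto
qed

lemma queries_ge_powr_large_k:
  fixes k n q :: nat
  assumes tester: "tolerant_junta_tester n k \<epsilon>1 \<epsilon>2 T" "makes_at_most q T" and "2 * k + 242 \<le> n"
    and eps: "1 / 100 \<le> \<epsilon>1" "\<epsilon>1 < \<epsilon>2" "\<epsilon>2 \<le> 49 / 100"
    and "1 \<le> D" "220 * D \<le> real k powr (1 / 200)" "- log 2 (\<epsilon>2 - \<epsilon>1) \<le> D * real k powr 0.99"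
  shows "real k powr (- log 2 (\<epsilon>2 - \<epsilon>1) / 20000) \<le> real q"
proof -
  define l where "l = - log 2 (\<epsilon>2 - \<epsilon>1)"
  have "2 \<le> q" by (rule at_least_two_queries[OF tester]) (use assms(3) eps in auto)
  have "1 \<le> k" using assms(7,8) by (cases "k = 0") auto
  have "0 \<le> l" using eps by (simp add: l_def)
  then obtain t :: nat where "1 \<le> t" "real t \<le> D * real k powr 0.99" "l \<le> 22 * real t"
      and gap: "t = 1 \<or> 11 * real t \<le> l"
    using exists_block_size[of l D "real k powr 0.99"] assms(7,9) \<open>1 \<le> k\<close>
    by (auto simp: l_def ge_one_powr_ge_zero)
  note bin_size = bin_size_ge[OF \<open>1 \<le> t\<close> \<open>1 \<le> k\<close> \<open>real t \<le> D * real k powr 0.99\<close> assms(8)]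
  have "real (bin_size k t) ^ t \<le> 3 * (real q)\<^sup>2"
    using gap
  proof
    assume "t = 1"
    then show ?thesis using bin_size_le_large_gap[OF tester] bin_size(1) assms(3) eps by simp
  next
    assume "11 * real t \<le> l"
    have "\<epsilon>2 - \<epsilon>1 = 2 powr (- l)" using eps by (simp add: l_def)
    also have "\<dots> \<le> 2 powr (- real (11 * t))" using \<open>11 * real t \<le> l\<close> by (intro powr_mono) auto
    also have "\<dots> = (1 / 2) ^ (11 * t)"
      unfolding powr_minus powr_realpow[OF zero_less_numeral]
      by (simp add: power_divide inverse_eq_divide)
    finally show ?thesis
      using \<open>1 \<le> t\<close> bin_size(1) assms(3) eps by (intro bin_size_power_le_small_gap[OF tester]) auto
  qed
  then have "real k powr (l / 20000) \<le> real q"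
    using \<open>l \<le> 22 * real t\<close>
    by (intro powr_le_of_power_le[OF \<open>2 \<le> q\<close> \<open>1 \<le> k\<close> bin_size(2)]) auto
  then show ?thesis by (simp add: l_def)
qed

lemma powr_le_two:
  fixes k :: nat
  assumes "0 < k" "real k \<le> K" "0 \<le> y" "y \<le> 1 / K"
  shows "real k powr y \<le> 2"
proof -
  have "real k < 2 ^ k" using less_exp[of k] by (metis of_nat_less_iff of_nat_numeral of_nat_power)
  then have "real k powr y \<le> (2 powr real k) powr y"
    using assms(3) by (intro powr_mono2) (auto simp: powr_realpow)
  also have "\<dots> = 2 powr (real k * y)" by (simp add: powr_powr)
  also have "\<dots> \<le> 2 powr 1"
  proof (rule powr_mono)
    have "real k * y \<le> K * (1 / K)" using assms by (intro mult_mono) auto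
    then show "real k * y \<le> 1" using assms(1,2) by simp
  qed simp
  finally show ?thesis by simp
qed

lemma queries_ge_powr:
  fixes k n q :: nat and D K c :: real
  assumes tester: "tolerant_junta_tester n k \<epsilon>1 \<epsilon>2 T" "makes_at_most q T"
    and n_ge: "2 * k + 242 \<le> n" and "0 < k"
    and eps: "1 / 100 \<le> \<epsilon>1" "\<epsilon>1 < \<epsilon>2" "\<epsilon>2 \<le> 49 / 100"
    and "1 \<le> D" and gap: "2 powr (- D * real k powr 0.99) \<le> \<epsilon>2 - \<epsilon>1"
    and K: "K = (220 * D) powr 200" and "0 \<le> c" "c \<le> 1 / 20000" "c \<le> 1 / (D * K\<^sup>2)"
  shows "real k powr (- c * log 2 (\<epsilon>2 - \<epsilon>1)) \<le> real q"
proof -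
  define l where "l = - log 2 (\<epsilon>2 - \<epsilon>1)"
  have "0 \<le> l" using eps by (simp add: l_def)
  have "- D * real k powr 0.99 \<le> log 2 (\<epsilon>2 - \<epsilon>1)"
    using gap eps by (subst le_log_iff) auto
  then have l_le: "l \<le> D * real k powr 0.99" by (simp add: l_def)
  have "1 \<le> K" unfolding K using \<open>1 \<le> D\<close> by (intro ge_one_powr_ge_zero) auto
  have "real k powr (c * l) \<le> real q"
  proof (cases "K \<le> real k")
    case True
    have "220 * D = K powr (1 / 200)" unfolding K powr_powr using \<open>1 \<le> D\<close> by simp
    also have "\<dots> \<le> real k powr (1 / 200)" using True \<open>1 \<le> K\<close> by (intro powr_mono2) auto
    finally have "real k powr (l / 20000) \<le> real q"
      using queries_ge_powr_large_k[OF tester n_ge eps \<open>1 \<le> D\<close>] l_le by (simp add: l_def)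
    moreover have "real k powr (c * l) \<le> real k powr (l / 20000)"
      using \<open>0 < k\<close> mult_right_mono[OF \<open>c \<le> 1 / 20000\<close> \<open>0 \<le> l\<close>] by (intro powr_mono) auto
    ultimately show ?thesis by linarith
  next
    case False
    have "real k powr 0.99 \<le> real k powr 1" using \<open>0 < k\<close> by (intro powr_mono) auto
    then have "D * real k powr 0.99 \<le> D * K"
      using False \<open>1 \<le> D\<close> \<open>0 < k\<close> by (intro mult_left_mono) auto
    with l_le have "l \<le> D * K" by linarith
    then have "c * l \<le> 1 / (D * K\<^sup>2) * (D * K)"
      using \<open>0 \<le> c\<close> \<open>c \<le> 1 / (D * K\<^sup>2)\<close> \<open>0 \<le> l\<close> \<open>1 \<le> D\<close> by (intro mult_mono) auto
    also have "\<dots> = 1 / K" using \<open>1 \<le> D\<close> \<open>1 \<le> K\<close> by (simp add: power2_eq_square)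
    finally have "real k powr (c * l) \<le> 2"
      using False \<open>0 < k\<close> \<open>0 \<le> c\<close> \<open>0 \<le> l\<close> by (intro powr_le_two[of k K]) auto
    moreover have "2 \<le> q" by (rule at_least_two_queries[OF tester]) (use n_ge eps in auto)
    ultimately show ?thesis by simp
  qed
  then show ?thesis by (simp add: l_def)
qed

theorem theorem1:
  "\<forall>C::real. C > 0 \<longrightarrow>
     (\<exists>c::real. c > 0 \<and>
       (\<forall>(k::nat) (\<epsilon>1::real) (\<epsilon>2::real).
          0 < k \<and> 0.01 \<le> \<epsilon>1 \<and> \<epsilon>1 < \<epsilon>2 \<and> \<epsilon>2 \<le> 0.49 \<and>
          \<epsilon>2 - \<epsilon>1 \<ge> 2 powr (- C * real k powr 0.99) \<longrightarrow>
          (\<exists>N::nat. \<forall>n\<ge>N. \<forall>(T::query_tree pmf) (q::nat).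
             tolerant_junta_tester n k \<epsilon>1 \<epsilon>2 T \<and> makes_at_most q T \<longrightarrow>
             real q \<ge> real k powr (- c * log 2 (\<epsilon>2 - \<epsilon>1)))))"
proof (intro allI impI)
  fix C :: real assume "C > 0"
  define D where "D = max 1 C"
  define K where "K = (220 * D) powr 200"
  define c where "c = min (1 / 20000) (1 / (D * K\<^sup>2))"
  have "1 \<le> D" "C \<le> D" by (simp_all add: D_def)
  then have "0 < K" unfolding K_def by (subst powr_gt_zero) simp
  with \<open>1 \<le> D\<close> have c_bounds: "0 < c" "c \<le> 1 / 20000" "c \<le> 1 / (D * K\<^sup>2)" by (simp_all add: c_def)
  have "real k powr (- c * log 2 (\<epsilon>2 - \<epsilon>1)) \<le> real q"
    if "0 < k" "0.01 \<le> \<epsilon>1" "\<epsilon>1 < \<epsilon>2" "\<epsilon>2 \<le> 0.49"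
      and gap: "2 powr (- C * real k powr 0.99) \<le> \<epsilon>2 - \<epsilon>1"
      and "2 * k + 242 \<le> n" "tolerant_junta_tester n k \<epsilon>1 \<epsilon>2 T" "makes_at_most q T"
    for k n q \<epsilon>1 \<epsilon>2 T
  proof (rule queries_ge_powr[OF that(7,8,6,1) _ that(3) _ \<open>1 \<le> D\<close> _ K_def])
    have "2 powr (- D * real k powr 0.99) \<le> 2 powr (- C * real k powr 0.99)"
      using \<open>C \<le> D\<close> by (intro powr_mono) (auto intro: mult_right_mono)
    with gap show "2 powr (- D * real k powr 0.99) \<le> \<epsilon>2 - \<epsilon>1" by linarith
  qed (use that(2,4) c_bounds in simp_all)
  with c_bounds(1) show "\<exists>c>0. \<forall>k \<epsilon>1 \<epsilon>2. 0 < k \<and> 0.01 \<le> \<epsilon>1 \<and> \<epsilon>1 < \<epsilon>2 \<and> \<epsilon>2 \<le> 0.49 \<and>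
      \<epsilon>2 - \<epsilon>1 \<ge> 2 powr (- C * real k powr 0.99) \<longrightarrow>
      (\<exists>N. \<forall>n\<ge>N. \<forall>T q. tolerant_junta_tester n k \<epsilon>1 \<epsilon>2 T \<and> makes_at_most q T \<longrightarrow>
        real q \<ge> real k powr (- c * log 2 (\<epsilon>2 - \<epsilon>1)))"
    by (intro exI[of _ c] conjI allI impI) blast+
qed

end
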